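(* Let $M\ge3$ be odd, $0<\chi\le1$, $T>0$. For a small parameter $\varepsilon\in(0,1]$ let $u_{ns}=u_{ns}(t,x)$ be the solution of $$\partial_tu_{ns}-\varepsilon\,\partial_{xx}u_{ns}=0\quad(x>0,\ 0<t\le T),\qquad u_{ns}(0,x)=0,$$ $$u_{ns}(t,0)-\varepsilon K_M(\chi)\,\partial_xu_{ns}(t,0)=u^w(t)+\varepsilon J_M(\chi)\,\partial_tu^w(t),$$ and let $$u_{ns}^a(t,x)=\hat u^{(0)}\!\left(t,\tfrac{x}{\sqrt\varepsilon}\right)+\sqrt\varepsilon\,\hat u^{(1)}\!\left(t,\tfrac{x}{\sqrt\varepsilon}\right)+\varepsilon\,\hat u^{(2)}\!\left(t,\tfrac{x}{\sqrt\varepsilon}\right),$$ where $K_M(\chi),J_M(\chi)$ and $\hat u^{(0)},\hat u^{(1)},\hat u^{(2)}$ are defined in the context. Then there is a constant $C(T)$ independent of $\varepsilon$ such that for every $t\in[0,T]$ $$\|(u_{ns}-u_{ns}^a)(t,\cdot)\|_{L^2(\mathbb{R}^+)}+\left(\int_0^T|u_{ns}(s,0)-u_{ns}^a(s,0)|^2\,ds\right)^{1/2}\le C(T)\,\varepsilon^{5/4}.$$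
   Context: **Matrices.** $\hat\chi=\frac{2\chi}{(2-\chi)\sqrt{2\pi}}$. $S_c$ is the symmetric positive definite $\frac{M+1}2\times\frac{M+1}2$ matrix with entries $S_c[i,j]=\frac12\int_{\mathbb{R}}|\xi|e^{-\xi^2/2}h_{2i}(\xi)h_{2j}(\xi)\,d\xi$, $0\le i,j\le\frac{M-1}2$, where $h_k$ are the Hermite polynomials orthonormal with respect to $(2\pi)^{-1/2}e^{-\xi^2/2}$ (only symmetry and positive definiteness of $S_c$ matter). $\tilde g=(\sqrt2,0,\dots,0)^T\in\mathbb{R}^{(M-1)/2}$. $\tilde M_c$ is the lower bidiagonal $\frac{M-1}2\times\frac{M-1}2$ matrix with diagonal $\sqrt3,\sqrt5,\dots,\sqrt M$ and subdiagonal $\sqrt4,\sqrt6,\dots,\sqrt{M-1}$. Fix an orthogonal matrix $R=\begin{pmatrix}R_e&R_e\\R_o&-R_o\end{pmatrix}$ ($R_e,R_o$ invertible of size $\frac{M-1}2$) and a positive diagonal matrix $\tilde\Lambda_+$ with $\begin{pmatrix}0&\tilde M_c\\\tilde M_c^T&0\end{pmatrix}R=R\,\mathrm{diag}(\tilde\Lambda_+,-\tilde\Lambda_+)$. Set $$H_M(\chi)=\hat\chi S_c\begin{pmatrix}1&-\tilde g^TR_e\\0&R_e\end{pmatrix}+\begin{pmatrix}0&0\\0&\tilde M_cR_o\end{pmatrix}$$ (invertible), and $$K_M(\chi)=(1,0)\,H_M(\chi)^{-1}\begin{pmatrix}1\\\tilde g\end{pmatrix},\qquad J_M(\chi)=-(1,0)\,H_M(\chi)^{-1}\hat\chi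 S_c\begin{pmatrix}0\\\tilde g\end{pmatrix},$$ where $(1,0)$ is the row vector extracting the first component. **Viscous-layer coefficients.** $u^w$ is a given function on $[0,T]$ with $u^w(0)=0$. The functions $\hat u^{(j)}(t,y)$, $y\ge0$, have zero initial data, vanish as $y\to\infty$, and solve $\partial_t\hat u^{(0)}=\partial_{yy}\hat u^{(0)}$, $\hat u^{(0)}(t,0)=u^w(t)$; $\partial_t\hat u^{(1)}=\partial_{yy}\hat u^{(1)}$, $\hat u^{(1)}(t,0)=K_M(\chi)\,\partial_y\hat u^{(0)}(t,0)$; $\partial_t\hat u^{(2)}-\partial_{yy}\hat u^{(2)}=\partial_{ty}\hat\sigma^{(1)}+\sqrt2\,\partial_{yy}\hat w_2^{(2)}$ with $\hat\sigma^{(1)}=-\partial_y\hat u^{(0)}$, $\hat w_2^{(2)}=-\sqrt2\,\partial_y\hat\sigma^{(1)}$, and $\hat u^{(2)}(t,0)=K_M(\chi)\,\partial_y\hat u^{(1)}(t,0)+J_M(\chi)\,\partial_tu^w(t)$. **Standing regularity assumption.** $u^w$ is such that these functions exist and, with $R^{ns}$ and $b_{ns}$ defined by $\partial_tu_{ns}^a-\varepsilon\partial_{xx}u_{ns}^a=\varepsilon R^{ns}(t,x/\sqrt\varepsilon)$ and $u_{ns}^a(t,0)-\varepsilon K_M(\chi)\partial_xu_{ns}^a(t,0)=u^w(t)+\varepsilon J_M(\chi)\partial_tu^w(t)+\varepsilon^{3/2}b_{ns}(t)$, there is $C$ independent of $\varepsilon$ with $\int_0^\infty|R^{ns}(t,x/\sqrt\varepsilon)|^2dx\le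 C\sqrt\varepsilon$ for $t\in[0,T]$ and $\int_0^Tb_{ns}^2\,dt\le C$. *)

theory Defs
  imports
    "HOL-Probability.Distributions"
    "Jordan_Normal_Form.Gauss_Jordan_Elimination"
begin

text \<open>Probabilists' Hermite polynomials, by the recursion equivalent to Rodrigues' formula
  \<open>He\<^sub>n(x) = (-1)\<^sup>n e\<^bsup>x\<^sup>2/2\<^esup> (d/dx)\<^sup>n e\<^bsup>-x\<^sup>2/2\<^esup>\<close>. Orthonormality of the normalised family \<open>hermite_h\<close>
  for the Gaussian weight is lemma \<open>hermite_h_orthonormal\<close>.\<close>

primrec hermite_He :: "nat \<Rightarrow> real poly" where
  "hermite_He 0 = 1"
| "hermite_He (Suc n) = [:0, 1:] * hermite_He n - pderiv (hermite_He n)"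

definition hermite_h :: "nat \<Rightarrow> real \<Rightarrow> real" where
  "hermite_h k \<xi> = poly (hermite_He k) \<xi> / sqrt (fact k)"

lemma integrable_gauss_poly:
  "integrable lborel (\<lambda>x. std_normal_density x * poly p x)"
proof -
  have "(\<lambda>x. std_normal_density x * poly p x)
      = (\<lambda>x. \<Sum>i\<le>degree p. coeff p i * (std_normal_density x * x ^ i))"
    by (rule ext) (simp add: poly_altdef sum_distrib_left mult_ac)
  then show ?thesis
    by (auto intro!: Bochner_Integration.integrable_sum integrable_mult_right
        integrable_std_normal_moment)
qed

lemma gauss_moment_step:
  "(\<integral>x. std_normal_density x * x ^ Suc n \<partial>lborel)
    = real n * (\<integral>x. std_normal_density x * x ^ (n - 1) \<partial>lborel)"
proof (cases "even n")
  case True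
  then obtain k where k: "n = 2 * k" by (elim evenE)
  show ?thesis
  proof (cases k)
    case 0
    with k show ?thesis using integral_std_normal_moment_odd[of 0] by simp
  next
    case (Suc j)
    with k have "n - 1 = 2 * j + 1" "Suc n = 2 * k + 1" by auto
    then show ?thesis by (simp only: integral_std_normal_moment_odd mult_zero_right)
  qed
next
  case False
  then obtain k where k: "n = 2 * k + 1" by (elim oddE)
  then have e: "Suc n = 2 * Suc k" "n - 1 = 2 * k" by auto
  have "fact (2 * Suc k) / (2 ^ Suc k * fact (Suc k))
      = (real (2 * k + 1)) * (fact (2 * k) / (2 ^ k * fact k) :: real)"
  proof -
    have f1: "(fact (2 * Suc k) :: real) = 2 * (real k + 1) * (real (2 * k + 1) * fact (2 * k))"
      by (simp add: algebra_simps)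
    have f2: "(2 ^ Suc k * fact (Suc k) :: real) = 2 * (real k + 1) * (2 ^ k * fact k)"
      by (simp add: algebra_simps)
    have "0 < 2 * (real k + 1)" by simp
    then have ne: "2 * (real k + 1) \<noteq> 0" by (metis less_irrefl)
    show ?thesis
      unfolding f1 f2 mult_divide_mult_cancel_left[OF ne] by (rule times_divide_eq_right[symmetric])
  qed
  then show ?thesis unfolding e integral_std_normal_moment_even unfolding k .
qed

lemma gauss_by_parts:
  "(\<integral>x. std_normal_density x * poly ([:0, 1:] * p) x \<partial>lborel)
    = (\<integral>x. std_normal_density x * poly (pderiv p) x \<partial>lborel)"
proof -
  let ?L = "\<lambda>p. \<integral>x. std_normal_density x * poly p x \<partial>lborel"
  have add: "?L (p + q) = ?L p + ?L q" for p q
    using Bochner_Integration.integral_add[OF integrable_gauss_poly integrable_gauss_poly]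
    by (simp add: distrib_left)
  have mono: "?L ([:0, 1:] * monom a n) = ?L (pderiv (monom a n))" for a n
  proof -
    have "?L ([:0, 1:] * monom a n) = (\<integral>x. a * (std_normal_density x * x ^ Suc n) \<partial>lborel)"
      by (simp add: poly_monom mult_ac)
    also have "\<dots> = a * real n * (\<integral>x. std_normal_density x * x ^ (n - 1) \<partial>lborel)"
      by (simp only: integral_mult_right_zero gauss_moment_step mult.assoc)
    also have "\<dots> = ?L (pderiv (monom a n))"
      by (simp add: pderiv_monom poly_monom mult_ac)
    finally show ?thesis .
  qed
  have all: "?L ([:0, 1:] * (\<Sum>i\<in>I. monom (coeff p i) i)) = ?L (pderiv (\<Sum>i\<in>I. monom (coeff p i) i))"
    if "finite I" for I
    using that
  proof (induction I rule: finite_induct)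
    case (insert i I)
    then show ?case
      by (simp only: sum.insert[OF insert(1,2)] distrib_left pderiv_add add mono)
  qed simp
  show ?thesis using all[of "{..degree p}"] by (simp only: poly_as_sum_of_monoms finite_atMost)
qed

lemma pderiv_hermite_He: "pderiv (hermite_He (Suc n)) = Polynomial.smult (real (Suc n)) (hermite_He n)"
proof (induction n)
  case 0
  then show ?case by (simp add: pderiv_pCons)
next
  case (Suc n)
  have "pderiv (hermite_He (Suc (Suc n)))
      = hermite_He (Suc n) + ([:0, 1:] * pderiv (hermite_He (Suc n)) - pderiv (pderiv (hermite_He (Suc n))))"
    by (subst hermite_He.simps(2), simp only: pderiv_diff pderiv_mult)
       (simp add: pderiv_pCons del: hermite_He.simps)
  also have "\<dots> = hermite_He (Suc n) + Polynomial.smult (real (Suc n)) (hermite_He (Suc n))"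
    unfolding Suc by (simp add: pderiv_smult smult_diff_right)
  also have "\<dots> = Polynomial.smult (1 + real (Suc n)) (hermite_He (Suc n))"
    by (simp only: smult_add_left Polynomial.smult_1_left)
  finally show ?case by (simp only: of_nat_Suc)
qed

lemma gauss_hermite_He:
  "(\<integral>x. std_normal_density x * poly (hermite_He (Suc j) * q) x \<partial>lborel)
    = (\<integral>x. std_normal_density x * poly (hermite_He j * pderiv q) x \<partial>lborel)"
proof -
  let ?L = "\<lambda>p. \<integral>x. std_normal_density x * poly p x \<partial>lborel"
  have "?L (hermite_He (Suc j) * q) = ?L ([:0, 1:] * (hermite_He j * q) - pderiv (hermite_He j) * q)"
    by (simp add: algebra_simps)
  also have "\<dots> = ?L ([:0, 1:] * (hermite_He j * q)) - ?L (pderiv (hermite_He j) * q)"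
    using Bochner_Integration.integral_diff[OF integrable_gauss_poly integrable_gauss_poly]
    by (simp only: poly_diff right_diff_distrib)
  also have "\<dots> = ?L (hermite_He j * pderiv q + pderiv (hermite_He j) * q) - ?L (pderiv (hermite_He j) * q)"
    unfolding gauss_by_parts pderiv_mult by (simp only: mult.commute[of q])
  also have "\<dots> = ?L (hermite_He j * pderiv q)"
    using Bochner_Integration.integral_add[OF integrable_gauss_poly integrable_gauss_poly]
    by (simp only: poly_add distrib_left)
  finally show ?thesis .
qed

lemma hermite_He_orthogonal:
  "(\<integral>x. std_normal_density x * poly (hermite_He j * hermite_He k) x \<partial>lborel)
    = (if j = k then fact j else 0)"
proof (induction j arbitrary: k)
  case 0
  show ?case
  proof (cases k)
    case 0
    then show ?thesis using integral_std_normal_moment_even[of 0] by simp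
  next
    case (Suc i)
    then show ?thesis using gauss_hermite_He[of i 1] by simp
  qed
next
  case (Suc j)
  show ?case
  proof (cases k)
    case 0
    then show ?thesis using gauss_hermite_He[of j 1] by simp
  next
    case k: (Suc i)
    have "(\<integral>x. std_normal_density x * poly (hermite_He (Suc j) * hermite_He k) x \<partial>lborel)
       = (\<integral>x. real (Suc i) * (std_normal_density x * poly (hermite_He j * hermite_He i) x) \<partial>lborel)"
      unfolding k gauss_hermite_He pderiv_hermite_He by (simp add: mult_ac)
    also have "\<dots> = real (Suc i) * (if j = i then fact j else 0)"
      by (simp only: integral_mult_right_zero Suc)
    finally show ?thesis by (simp add: k)
  qed
qed

lemma hermite_h_orthonormal:
  "(\<integral>\<xi>. (2 * pi) powr (- 1 / 2) * exp (- \<xi>\<^sup>2 / 2) * hermite_h j \<xi> * hermite_h k \<xi> \<partial>lborel)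
    = (if j = k then 1 else 0)"
proof -
  have "(2 * pi) powr (- 1 / 2) = 1 / sqrt (2 * pi)"
    using powr_minus_divide[of "2 * pi" "1 / 2"] powr_half_sqrt[of "2 * pi"] pi_ge_zero
    by (metis minus_divide_left mult_nonneg_nonneg zero_le_numeral)
  then have *: "(2 * pi) powr (- 1 / 2) * exp (- \<xi>\<^sup>2 / 2) = std_normal_density \<xi>" for \<xi>
    by (simp only: std_normal_density_def)
  have "(\<integral>\<xi>. (2 * pi) powr (- 1 / 2) * exp (- \<xi>\<^sup>2 / 2) * hermite_h j \<xi> * hermite_h k \<xi> \<partial>lborel)
      = (\<integral>\<xi>. (1 / (sqrt (fact j) * sqrt (fact k)))
            * (std_normal_density \<xi> * poly (hermite_He j * hermite_He k) \<xi>) \<partial>lborel)"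
    unfolding * hermite_h_def poly_mult
    by (rule Bochner_Integration.integral_cong) (simp_all add: field_simps)
  also have "\<dots> = (1 / (sqrt (fact j) * sqrt (fact k))) * (if j = k then fact j else 0)"
    by (simp only: integral_mult_right_zero hermite_He_orthogonal)
  also have "\<dots> = (if j = k then 1 else 0)" by simp
  finally show ?thesis .
qed

lemma hermite_He_degree: "degree (hermite_He n) = n \<and> lead_coeff (hermite_He n) = 1"
proof (induction n)
  case (Suc n)
  have c: "coeff (hermite_He n) n = 1" using Suc by metis
  have x: "degree ([:0, 1:] * hermite_He n) = Suc n"
    using Suc by (subst degree_mult_eq) auto
  have d: "degree (pderiv (hermite_He n)) < Suc n" using Suc by (simp add: degree_pderiv)
  have "degree (hermite_He (Suc n)) = Suc n"
    using x d degree_add_eq_left[of "- pderiv (hermite_He n)" "[:0, 1:] * hermite_He n"] by simp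
  moreover have "coeff (hermite_He (Suc n)) (Suc n) = 1"
    using c d by (simp add: coeff_eq_0)
  ultimately show ?case by simp
qed simp


definition chi_hat :: "real \<Rightarrow> real" where
  "chi_hat chi = 2 * chi / ((2 - chi) * sqrt (2 * pi))"

definition S_c :: "nat \<Rightarrow> real mat" where
  "S_c M = Matrix.mat ((M + 1) div 2) ((M + 1) div 2) (\<lambda>(i, j).
     1 / 2 * (\<integral>\<xi>. \<bar>\<xi>\<bar> * exp (- \<xi>\<^sup>2 / 2) * hermite_h (2 * i) \<xi> * hermite_h (2 * j) \<xi> \<partial>lborel))"

definition g_tilde :: "nat \<Rightarrow> real Matrix.vec" where
  "g_tilde M = Matrix.vec ((M - 1) div 2) (\<lambda>i. if i = 0 then sqrt 2 else 0)"

definition M_c :: "nat \<Rightarrow> real mat" where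
  "M_c M = Matrix.mat ((M - 1) div 2) ((M - 1) div 2) (\<lambda>(i, j).
     if i = j then sqrt (real (2 * i + 3)) else if i = j + 1 then sqrt (real (2 * j + 4)) else 0)"

text \<open>Orthogonality of \<open>R\<close> is in the usual sense \<open>R\<^sup>T R = R R\<^sup>T = 1\<close>; the library's \<open>orthogonal_mat\<close>
  does not normalise the columns.\<close>

definition spectral_frame :: "nat \<Rightarrow> real mat \<Rightarrow> real mat \<Rightarrow> real mat \<Rightarrow> bool" where
  "spectral_frame M R\<^sub>e R\<^sub>o \<Lambda> \<longleftrightarrow>
    (let m = (M - 1) div 2;
         R = four_block_mat R\<^sub>e R\<^sub>e R\<^sub>o (- R\<^sub>o)
     in R\<^sub>e \<in> carrier_mat m m \<and> invertible_mat R\<^sub>e \<and>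
        R\<^sub>o \<in> carrier_mat m m \<and> invertible_mat R\<^sub>o \<and>
        transpose_mat R * R = 1\<^sub>m (2 * m) \<and> R * transpose_mat R = 1\<^sub>m (2 * m) \<and>
        \<Lambda> \<in> carrier_mat m m \<and> diagonal_mat \<Lambda> \<and> (\<forall>i<m. \<Lambda> $$ (i, i) > 0) \<and>
        four_block_mat (0\<^sub>m m m) (M_c M) (transpose_mat (M_c M)) (0\<^sub>m m m) * R
          = R * four_block_mat \<Lambda> (0\<^sub>m m m) (0\<^sub>m m m) (- \<Lambda>))"

definition H_mat :: "nat \<Rightarrow> real \<Rightarrow> real mat \<Rightarrow> real mat \<Rightarrow> real mat" where
  "H_mat M chi R\<^sub>e R\<^sub>o =
    (let m = (M - 1) div 2
     in chi_hat chi \<cdot>\<^sub>m (S_c M * four_block_mat (1\<^sub>m 1) (- (mat_of_row (g_tilde M) * R\<^sub>e)) (0\<^sub>m m 1) R\<^sub>e)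
        + four_block_mat (0\<^sub>m 1 1) (0\<^sub>m 1 m) (0\<^sub>m m 1) (M_c M * R\<^sub>o))"

definition K_coef :: "nat \<Rightarrow> real \<Rightarrow> real mat \<Rightarrow> real mat \<Rightarrow> real" where
  "K_coef M chi R\<^sub>e R\<^sub>o =
    vec_index (the (mat_inverse (H_mat M chi R\<^sub>e R\<^sub>o)) *\<^sub>v vCons 1 (g_tilde M)) 0"

definition J_coef :: "nat \<Rightarrow> real \<Rightarrow> real mat \<Rightarrow> real mat \<Rightarrow> real" where
  "J_coef M chi R\<^sub>e R\<^sub>o =
    - vec_index (the (mat_inverse (H_mat M chi R\<^sub>e R\<^sub>o)) *\<^sub>v
        ((chi_hat chi \<cdot>\<^sub>m S_c M) *\<^sub>v vCons 0 (g_tilde M))) 0"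


text \<open>Functions of \<open>(t, x)\<close> are only meaningful on \<open>[0,T] \<times> [0,\<infinity>)\<close>, so partial derivatives are taken
  within that set (one-sided at its boundary).\<close>

definition ddt :: "real \<Rightarrow> (real \<Rightarrow> real) \<Rightarrow> real \<Rightarrow> real" where
  "ddt T f t = vector_derivative f (at t within {0..T})"

definition partial_t :: "real \<Rightarrow> (real \<Rightarrow> real \<Rightarrow> real) \<Rightarrow> real \<Rightarrow> real \<Rightarrow> real" where
  "partial_t T u t x = ddt T (\<lambda>s. u s x) t"

definition partial_x :: "(real \<Rightarrow> real \<Rightarrow> real) \<Rightarrow> real \<Rightarrow> real \<Rightarrow> real" where
  "partial_x u t x = vector_derivative (u t) (at x within {0..})"

definition differentiable_t :: "real \<Rightarrow> (real \<Rightarrow> real \<Rightarrow> real) \<Rightarrow> bool" where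
  "differentiable_t T u \<longleftrightarrow>
    (\<forall>t\<in>{0<..T}. \<forall>x>0. (\<lambda>s. u s x) differentiable (at t within {0..T}))"

definition differentiable_x :: "real \<Rightarrow> (real \<Rightarrow> real \<Rightarrow> real) \<Rightarrow> bool" where
  "differentiable_x T u \<longleftrightarrow>
    (\<forall>t\<in>{0<..T}. \<forall>x>0. u t differentiable (at x within {0..}))"

text \<open>Bounded classical functions: continuous and bounded up to \<open>t = 0\<close> and \<open>x = 0\<close>, with continuous
  \<open>\<partial>\<^sub>x\<close> up to \<open>x = 0\<close> for positive times, and continuous \<open>\<partial>\<^sub>t\<close> and \<open>\<partial>\<^sub>x\<^sub>x\<close> inside. Boundedness selects the
  usual uniqueness class for the heat equation on the half line.\<close>

definition bounded_classical :: "real \<Rightarrow> (real \<Rightarrow> real \<Rightarrow> real) \<Rightarrow> bool" where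
  "bounded_classical T u \<longleftrightarrow>
    continuous_on ({0..T} \<times> {0..}) (\<lambda>(t, x). u t x) \<and>
    bounded ((\<lambda>(t, x). u t x) ` ({0..T} \<times> {0..})) \<and>
    (\<forall>t\<in>{0<..T}. \<forall>x\<ge>0. u t differentiable (at x within {0..})) \<and>
    continuous_on ({0<..T} \<times> {0..}) (\<lambda>(t, x). partial_x u t x) \<and>
    differentiable_t T u \<and>
    continuous_on ({0<..T} \<times> {0<..}) (\<lambda>(t, x). partial_t T u t x) \<and>
    differentiable_x T (partial_x u) \<and>
    continuous_on ({0<..T} \<times> {0<..}) (\<lambda>(t, x). partial_x (partial_x u) t x)"

definition heat_equation ::
    "real \<Rightarrow> real \<Rightarrow> (real \<Rightarrow> real \<Rightarrow> real) \<Rightarrow> (real \<Rightarrow> real \<Rightarrow> real) \<Rightarrow> bool" where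
  "heat_equation T \<nu> f u \<longleftrightarrow>
    (\<forall>t\<in>{0<..T}. \<forall>x>0. partial_t T u t x - \<nu> * partial_x (partial_x u) t x = f t x)"

definition zero_initial :: "(real \<Rightarrow> real \<Rightarrow> real) \<Rightarrow> bool" where
  "zero_initial u \<longleftrightarrow> (\<forall>x\<ge>0. u 0 x = 0)"

definition vanishes_at_infinity :: "real \<Rightarrow> (real \<Rightarrow> real \<Rightarrow> real) \<Rightarrow> bool" where
  "vanishes_at_infinity T u \<longleftrightarrow> (\<forall>t\<in>{0..T}. (u t \<longlongrightarrow> 0) at_top)"


definition layer_sigma1 :: "(real \<Rightarrow> real \<Rightarrow> real) \<Rightarrow> real \<Rightarrow> real \<Rightarrow> real" where
  "layer_sigma1 u0 t y = - partial_x u0 t y"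

definition layer_w2 :: "(real \<Rightarrow> real \<Rightarrow> real) \<Rightarrow> real \<Rightarrow> real \<Rightarrow> real" where
  "layer_w2 u0 t y = - sqrt 2 * partial_x (layer_sigma1 u0) t y"

definition viscous_layer ::
    "real \<Rightarrow> real \<Rightarrow> real \<Rightarrow> (real \<Rightarrow> real) \<Rightarrow> (real \<Rightarrow> real \<Rightarrow> real) \<Rightarrow>
     (real \<Rightarrow> real \<Rightarrow> real) \<Rightarrow> (real \<Rightarrow> real \<Rightarrow> real) \<Rightarrow> bool" where
  "viscous_layer T K J uw u0 u1 u2 \<longleftrightarrow>
    (\<forall>u\<in>{u0, u1, u2}. bounded_classical T u \<and> zero_initial u \<and> vanishes_at_infinity T u) \<and>
    heat_equation T 1 (\<lambda>t y. 0) u0 \<and>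
    (\<forall>t\<in>{0<..T}. u0 t 0 = uw t) \<and>
    heat_equation T 1 (\<lambda>t y. 0) u1 \<and>
    (\<forall>t\<in>{0<..T}. u1 t 0 = K * partial_x u0 t 0) \<and>
    differentiable_t T (partial_x (layer_sigma1 u0)) \<and>
    differentiable_x T (layer_w2 u0) \<and> differentiable_x T (partial_x (layer_w2 u0)) \<and>
    heat_equation T 1
      (\<lambda>t y. partial_t T (partial_x (layer_sigma1 u0)) t y
              + sqrt 2 * partial_x (partial_x (layer_w2 u0)) t y) u2 \<and>
    (\<forall>t\<in>{0<..T}. u2 t 0 = K * partial_x u1 t 0 + J * ddt T uw t)"

definition u_ns_a ::
    "(real \<Rightarrow> real \<Rightarrow> real) \<Rightarrow> (real \<Rightarrow> real \<Rightarrow> real) \<Rightarrow> (real \<Rightarrow> real \<Rightarrow> real) \<Rightarrow>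
     real \<Rightarrow> real \<Rightarrow> real \<Rightarrow> real" where
  "u_ns_a u0 u1 u2 \<epsilon> t x =
    u0 t (x / sqrt \<epsilon>) + sqrt \<epsilon> * u1 t (x / sqrt \<epsilon>) + \<epsilon> * u2 t (x / sqrt \<epsilon>)"

text \<open>\<open>R_ns\<close> and \<open>b_ns\<close> below are the defining relations
  \<open>\<partial>\<^sub>t ua - \<epsilon> \<partial>\<^sub>x\<^sub>x ua = \<epsilon> R(t, x/\<surd>\<epsilon>)\<close> and \<open>ua(t,0) - \<epsilon> K \<partial>\<^sub>x ua(t,0) = uw + \<epsilon> J uw' + \<epsilon>\<^bsup>3/2\<^esup> b\<close>
  solved for \<open>R\<close> and \<open>b\<close>.\<close>

definition R_ns :: "real \<Rightarrow> real \<Rightarrow> (real \<Rightarrow> real \<Rightarrow> real) \<Rightarrow> real \<Rightarrow> real \<Rightarrow> real" where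
  "R_ns T \<epsilon> ua t y =
    (partial_t T ua t (sqrt \<epsilon> * y) - \<epsilon> * partial_x (partial_x ua) t (sqrt \<epsilon> * y)) / \<epsilon>"

definition b_ns ::
    "real \<Rightarrow> real \<Rightarrow> real \<Rightarrow> real \<Rightarrow> (real \<Rightarrow> real) \<Rightarrow> (real \<Rightarrow> real \<Rightarrow> real) \<Rightarrow> real \<Rightarrow> real" where
  "b_ns T K J \<epsilon> uw ua t =
    (ua t 0 - \<epsilon> * K * partial_x ua t 0 - (uw t + \<epsilon> * J * ddt T uw t)) / \<epsilon> powr (3 / 2)"

definition square_integrable_on :: "real set \<Rightarrow> (real \<Rightarrow> real) \<Rightarrow> bool" where
  "square_integrable_on S f \<longleftrightarrow> set_integrable lborel S (\<lambda>x. (f x)\<^sup>2)"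

definition L2_sq :: "real set \<Rightarrow> (real \<Rightarrow> real) \<Rightarrow> real" where
  "L2_sq S f = set_lebesgue_integral lborel S (\<lambda>x. (f x)\<^sup>2)"

definition residual_bounds ::
    "real \<Rightarrow> real \<Rightarrow> real \<Rightarrow> (real \<Rightarrow> real) \<Rightarrow> (real \<Rightarrow> real \<Rightarrow> real \<Rightarrow> real) \<Rightarrow> bool" where
  "residual_bounds T K J uw ua \<longleftrightarrow>
    (\<exists>C. \<forall>\<epsilon>\<in>{0<..1}.
      (\<forall>t\<in>{0..T}.
        square_integrable_on {0<..} (\<lambda>x. R_ns T \<epsilon> (ua \<epsilon>) t (x / sqrt \<epsilon>)) \<and>
        L2_sq {0<..} (\<lambda>x. R_ns T \<epsilon> (ua \<epsilon>) t (x / sqrt \<epsilon>)) \<le> C * sqrt \<epsilon>) \<and>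
      square_integrable_on {0..T} (b_ns T K J \<epsilon> uw (ua \<epsilon>)) \<and>
      L2_sq {0..T} (b_ns T K J \<epsilon> uw (ua \<epsilon>)) \<le> C)"

definition ns_solution ::
    "real \<Rightarrow> real \<Rightarrow> real \<Rightarrow> real \<Rightarrow> (real \<Rightarrow> real) \<Rightarrow> (real \<Rightarrow> real \<Rightarrow> real) \<Rightarrow> bool" where
  "ns_solution T K J \<epsilon> uw u \<longleftrightarrow>
    bounded_classical T u \<and> zero_initial u \<and>
    heat_equation T \<epsilon> (\<lambda>t x. 0) u \<and>
    (\<forall>t\<in>{0<..T}. u t 0 - \<epsilon> * K * partial_x u t 0 = uw t + \<epsilon> * J * ddt T uw t)"

end

theory Submission
  imports Defs "Jordan_Normal_Form.Determinant"
begin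

text \<open>
  The error \<open>v = u_ns - ua\<close> solves the heat equation with source \<open>-\<epsilon> R\<close> and Robin data \<open>-\<epsilon>\<^bsup>3/2\<^esup> b\<close>.
  Substituting the Robin condition into the energy identity turns the boundary flux into
  \<open>-2 \<epsilon> v v\<^sub>x \<le> (\<epsilon>\<^sup>3 b\<^sup>2 - v\<^sup>2) / K\<close>, so that \<open>K > 0\<close> makes it dissipative and a Gronwall argument yields
  the rate \<open>\<epsilon>\<^bsup>5/2\<^esup>\<close> for the squared norms. As \<open>v\<close> is only known to be bounded, and regular inside for
  positive times, the identity is first taken on \<open>[a, L]\<close> with weight \<open>(1 - x/L)\<^sup>2\<close>, whose commutator term
  is \<open>O(1/L)\<close>, and on times \<open>[s, \<tau>]\<close>; then \<open>a \<rightarrow> 0\<close>, \<open>s \<rightarrow> 0\<close>, \<open>L \<rightarrow> \<infinity>\<close>.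

  Positivity of \<open>K\<close>: if \<open>H x = (1, g)\<close> and \<open>y\<close> is the vector that \<open>\<chi> S\<^sub>c\<close> multiplies in \<open>H x\<close>, then
  \<open>K = x\<^sub>0 = y\<^sup>T H x = \<chi> y\<^sup>T S\<^sub>c y + x'\<^sup>T \<Lambda> x' / 2 > 0\<close>, because \<open>R\<^sub>e\<^sup>T R\<^sub>e = 1/2\<close> and \<open>M\<^sub>c R\<^sub>o = R\<^sub>e \<Lambda>\<close>.
\<close>

section \<open>Positivity of the slip coefficient\<close>

text \<open>Up to the factor \<open>sqrt (2 * pi)\<close> the integrand has the modulus of
  \<open>std_normal_density \<xi> * poly ([:0, 1:] * p) \<xi>\<close>: the extra
  \<open>\<bar>\<xi>\<bar>\<close> is absorbed by raising the degree.\<close>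

lemma integrable_abs_gauss_poly:
  fixes p :: "real poly"
  shows "integrable lborel (\<lambda>\<xi>. \<bar>\<xi>\<bar> * exp (- \<xi>\<^sup>2 / 2) * poly p \<xi>)"
proof -
  have "integrable lborel (\<lambda>x. sqrt (2 * pi) * \<bar>std_normal_density x * poly ([:0, 1:] * p) x\<bar>)"
    by (intro integrable_mult_right integrable_abs integrable_gauss_poly)
  then show ?thesis
  proof (rule Bochner_Integration.integrable_bound)
    show "(\<lambda>\<xi>. \<bar>\<xi>\<bar> * exp (- \<xi>\<^sup>2 / 2) * poly p \<xi>) \<in> borel_measurable lborel"
      unfolding measurable_lborel2 by (intro borel_measurable_continuous_onI continuous_intros) auto
  qed (auto simp: std_normal_density_def abs_mult)
qed

text \<open>A step of back substitution: \<open>hermite_He (2 * i)\<close> is monic of degree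
  \<open>2 * i\<close>, so indices below \<open>k\<close> do not reach this coefficient, and those
  above \<open>k\<close> are excluded by hypothesis.\<close>

lemma coeff_sum_even_hermite_top:
  assumes "k < n" and "\<And>i. k < i \<Longrightarrow> i < n \<Longrightarrow> c i = 0"
  shows "poly.coeff (\<Sum>i<n. Polynomial.smult (c i) (hermite_He (2 * i))) (2 * k) = c k"
proof -
  have "poly.coeff (\<Sum>i<n. Polynomial.smult (c i) (hermite_He (2 * i))) (2 * k)
      = (\<Sum>i<n. c i * poly.coeff (hermite_He (2 * i)) (2 * k))"
    by (simp add: coeff_sum)
  also have "\<dots> = (\<Sum>i<n. if i = k then c k else 0)"
  proof (rule sum.cong[OF refl])
    fix i assume "i \<in> {..<n}"
    then have "i < n" by simp
    consider "i < k" | "i = k" | "k < i" by linarith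
    then show "c i * poly.coeff (hermite_He (2 * i)) (2 * k) = (if i = k then c k else 0)"
    proof cases
      case 1
      then have "degree (hermite_He (2 * i)) < 2 * k" using hermite_He_degree[of "2 * i"] by simp
      then show ?thesis using 1 by (simp add: coeff_eq_0)
    next
      case 2
      then show ?thesis using hermite_He_degree[of "2 * k"] by (metis mult.right_neutral)
    next
      case 3
      then show ?thesis using assms(2) \<open>i < n\<close> by simp
    qed
  qed
  also have "\<dots> = c k" using assms(1) by simp
  finally show ?thesis .
qed

lemma even_hermite_independent:
  assumes "(\<Sum>i<n. Polynomial.smult (c i) (hermite_He (2 * i))) = 0" and "k < n"
  shows "c k = 0"
  using \<open>k < n\<close>
\<comment> \<open>Induction on \<open>n - k\<close> runs downwards in \<open>k\<close>: all
  coefficients above \<open>k\<close> are already known to vanish.\<close>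
proof (induction "n - k" arbitrary: k rule: less_induct)
  case less
  have "c i = 0" if "k < i" "i < n" for i using less(1)[of i] that by simp
  then show ?case using coeff_sum_even_hermite_top[of k n c] less(2) assms(1) by simp
qed

text \<open>\<open>S_c M\<close> is the Gram matrix of the even normalised Hermite polynomials for
  the weight \<open>1 / 2 * \<bar>\<xi>\<bar> * exp (- \<xi>\<^sup>2 / 2)\<close>, and
  \<open>p\<close> is the polynomial with coordinates \<open>y\<close> in that family.\<close>

lemma S_c_quadratic_form:
  assumes "y \<in> carrier_vec ((M + 1) div 2)"
  defines "p \<equiv> (\<Sum>i<(M + 1) div 2. Polynomial.smult (vec_index y i / sqrt (fact (2 * i))) (hermite_He (2 * i)))"
  shows "scalar_prod y (S_c M *\<^sub>v y) = 1 / 2 * (\<integral>\<xi>. \<bar>\<xi>\<bar> * exp (- \<xi>\<^sup>2 / 2) * poly (p * p) \<xi> \<partial>lborel)"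
proof -
  let ?n = "(M + 1) div 2"
  let ?w = "\<lambda>\<xi>. \<bar>\<xi>\<bar> * exp (- \<xi>\<^sup>2 / 2)"
  let ?h = "\<lambda>i j \<xi>. ?w \<xi> * hermite_h (2 * i) \<xi> * hermite_h (2 * j) \<xi>"
  have int: "integrable lborel (?h i j)" for i j
  proof -
    have "?h i j = (\<lambda>\<xi>. ?w \<xi> * poly (Polynomial.smult (1 / (sqrt (fact (2 * i)) * sqrt (fact (2 * j)))) (hermite_He (2 * i) * hermite_He (2 * j))) \<xi>)"
      by (rule ext) (simp add: hermite_h_def)
    then show ?thesis by (simp only: integrable_abs_gauss_poly)
  qed
  have pe: "poly p \<xi> = (\<Sum>i<?n. vec_index y i * hermite_h (2 * i) \<xi>)" for \<xi>
    by (simp add: p_def poly_sum hermite_h_def)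
  have "scalar_prod y (S_c M *\<^sub>v y)
      = (\<Sum>i<?n. vec_index y i * (\<Sum>j<?n. 1 / 2 * integral\<^sup>L lborel (?h i j) * vec_index y j))"
    using assms(1) unfolding scalar_prod_def
    by (intro sum.cong) (auto simp: S_c_def scalar_prod_def atLeast0LessThan)
  also have "\<dots> = 1 / 2 * (\<Sum>i<?n. \<Sum>j<?n. (\<integral>\<xi>. vec_index y i * vec_index y j * ?h i j \<xi> \<partial>lborel))"
    by (simp add: sum_distrib_left mult.assoc mult.left_commute[of _ "1 / 2"])
       (simp add: mult_ac)
  also have "\<dots> = 1 / 2 * (\<integral>\<xi>. (\<Sum>i<?n. \<Sum>j<?n. vec_index y i * vec_index y j * ?h i j \<xi>) \<partial>lborel)"
    using int by (simp add: Bochner_Integration.integral_sum Bochner_Integration.integrable_sum)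
  also have "(\<lambda>\<xi>. \<Sum>i<?n. \<Sum>j<?n. vec_index y i * vec_index y j * ?h i j \<xi>) = (\<lambda>\<xi>. ?w \<xi> * poly (p * p) \<xi>)"
    by (rule ext) (simp add: pe sum_product sum_distrib_left mult_ac)
  finally show ?thesis .
qed

lemma S_c_nonneg:
  assumes "y \<in> carrier_vec ((M + 1) div 2)"
  shows "0 \<le> scalar_prod y (S_c M *\<^sub>v y)"
  unfolding S_c_quadratic_form[OF assms] by (simp add: Bochner_Integration.integral_nonneg)

lemma S_c_positive_definite:
  assumes y: "y \<in> carrier_vec ((M + 1) div 2)" and "y \<noteq> 0\<^sub>v ((M + 1) div 2)"
  shows "0 < scalar_prod y (S_c M *\<^sub>v y)"
proof -
  let ?n = "(M + 1) div 2"
  let ?w = "\<lambda>\<xi>. \<bar>\<xi>\<bar> * exp (- \<xi>\<^sup>2 / 2)"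
  define p where "p = (\<Sum>i<?n. Polynomial.smult (vec_index y i / sqrt (fact (2 * i))) (hermite_He (2 * i)))"
  have "scalar_prod y (S_c M *\<^sub>v y) \<noteq> 0"
  proof
    assume "scalar_prod y (S_c M *\<^sub>v y) = 0"
    then have "(\<integral>\<xi>. ?w \<xi> * poly (p * p) \<xi> \<partial>lborel) = 0"
      using S_c_quadratic_form[OF y] unfolding p_def by simp
    then have "AE \<xi> in lborel. ?w \<xi> * poly (p * p) \<xi> = 0"
      using integral_nonneg_eq_0_iff_AE[OF integrable_abs_gauss_poly[of "p * p"]] by simp
    \<comment> \<open>The weight vanishes only at the origin. Multiplying \<open>p\<close> by
      \<open>\<xi>\<close> makes this exceptional point a root, so a single polynomial vanishes
      almost everywhere; if \<open>p\<close> were nonzero, its finite root set would be null, which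
      is absurd.\<close>
    then have "AE \<xi> in lborel. poly ([:0, 1:] * p) \<xi> = 0" by eventually_elim auto
    moreover have "AE \<xi> in lborel. poly ([:0, 1:] * p) \<xi> \<noteq> 0" if "p \<noteq> 0"
      using AE_not_in[OF finite_imp_null_set_lborel[OF poly_roots_finite[of "[:0, 1:] * p"]]] that by simp
    ultimately have "AE \<xi> in (lborel :: real measure). False" if "p \<noteq> 0"
      using that by (auto elim: eventually_elim2)
    then have "p = 0" by (auto simp: eventually_False ae_filter_eq_bot_iff)
    then have "vec_index y i / sqrt (fact (2 * i)) = 0" if "i < ?n" for i
      using even_hermite_independent[of "\<lambda>i. vec_index y i / sqrt (fact (2 * i))" ?n i] that
      unfolding p_def by simp
    then have "y = 0\<^sub>v ?n" using y by (intro eq_vecI) auto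
    then show False using assms by simp
  qed
  then show ?thesis using S_c_nonneg[OF y] by simp
qed

text \<open>The first claim is the upper left block of the eigenvalue relation. For the second, put
  \<open>?e = transpose_mat R\<^sub>e * R\<^sub>e\<close> and
  \<open>?o = transpose_mat R\<^sub>o * R\<^sub>o\<close>: the upper blocks of the orthogonality
  relation say that their sum is the identity and their difference is zero.\<close>

lemma spectral_frame_blocks:
  assumes "spectral_frame M R\<^sub>e R\<^sub>o \<Lambda>"
  defines "m \<equiv> (M - 1) div 2"
  shows "M_c M * R\<^sub>o = R\<^sub>e * \<Lambda>" and "transpose_mat R\<^sub>e * R\<^sub>e = (1 / 2) \<cdot>\<^sub>m 1\<^sub>m m"
proof -
  note * = assms(1)[unfolded spectral_frame_def Let_def, folded m_def]
  have c: "R\<^sub>e \<in> carrier_mat m m" "R\<^sub>o \<in> carrier_mat m m" "\<Lambda> \<in> carrier_mat m m"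
    "- R\<^sub>o \<in> carrier_mat m m" "- \<Lambda> \<in> carrier_mat m m"
    using * by auto
  have cM: "M_c M \<in> carrier_mat m m" "transpose_mat (M_c M) \<in> carrier_mat m m" by (auto simp: M_c_def m_def)
  have z: "0\<^sub>m m m \<in> carrier_mat m m" by simp
  have blk: "P = P'" "Q = Q'"
    if "four_block_mat P Q X D = four_block_mat P' Q' X' D'"
      "P \<in> carrier_mat m m" "P' \<in> carrier_mat m m" "Q \<in> carrier_mat m m" "Q' \<in> carrier_mat m m"
      "D \<in> carrier_mat m m" "D' \<in> carrier_mat m m"
    for P Q X D P' Q' X' D' :: "real mat"
  proof -
    have e: "four_block_mat P Q X D $$ (i, j) = four_block_mat P' Q' X' D' $$ (i, j)" for i j
      using that(1) by simp
    show "P = P'"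
    proof (rule eq_matI)
      fix i j assume "i < dim_row P'" "j < dim_col P'"
      then show "P $$ (i, j) = P' $$ (i, j)" using e[of i j] that(2-) by auto
    qed (use that(2-) in auto)
    show "Q = Q'"
    proof (rule eq_matI)
      fix i j assume "i < dim_row Q'" "j < dim_col Q'"
      then show "Q $$ (i, j) = Q' $$ (i, j)" using e[of i "j + m"] that(2-) by auto
    qed (use that(2-) in auto)
  qed
  let ?R = "four_block_mat R\<^sub>e R\<^sub>e R\<^sub>o (- R\<^sub>o)"
  have eig: "four_block_mat (0\<^sub>m m m) (M_c M) (transpose_mat (M_c M)) (0\<^sub>m m m) * ?R
          = ?R * four_block_mat \<Lambda> (0\<^sub>m m m) (0\<^sub>m m m) (- \<Lambda>)" using * by blast
  have "0\<^sub>m m m * R\<^sub>e + M_c M * R\<^sub>o = R\<^sub>e * \<Lambda> + R\<^sub>e * 0\<^sub>m m m"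
    using eig unfolding mult_four_block_mat[OF z cM z c(1) c(1) c(2) c(4)]
      mult_four_block_mat[OF c(1) c(1) c(2) c(4) c(3) z z c(5)]
    by (rule blk(1)) (use c cM in auto)
  then show "M_c M * R\<^sub>o = R\<^sub>e * \<Lambda>" using c cM by simp
  let ?e = "transpose_mat R\<^sub>e * R\<^sub>e" and ?o = "transpose_mat R\<^sub>o * R\<^sub>o"
  have ct: "transpose_mat R\<^sub>e \<in> carrier_mat m m" "transpose_mat R\<^sub>o \<in> carrier_mat m m"
    "transpose_mat (- R\<^sub>o) \<in> carrier_mat m m" using c by auto
  have one: "1\<^sub>m (2 * m) = four_block_mat (1\<^sub>m m) (0\<^sub>m m m) (0\<^sub>m m m) (1\<^sub>m m :: real mat)"
    by (rule eq_matI) auto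
  have orth: "transpose_mat ?R * ?R = 1\<^sub>m (2 * m)" using * by blast
  note o = orth[unfolded one transpose_four_block_mat[OF c(1) c(1) c(2) c(4)]
        mult_four_block_mat[OF ct(1) ct(2) ct(1) ct(3) c(1) c(1) c(2) c(4)]]
  have 1: "?e + ?o = 1\<^sub>m m" using o by (rule blk(1)) (use c ct in auto)
  have 2: "?e + transpose_mat R\<^sub>o * (- R\<^sub>o) = 0\<^sub>m m m" using o by (rule blk(2)) (use c ct in auto)
  show "?e = (1 / 2) \<cdot>\<^sub>m 1\<^sub>m m"
  proof (rule eq_matI)
    fix i j assume "i < dim_row ((1 / 2) \<cdot>\<^sub>m 1\<^sub>m m :: real mat)" "j < dim_col ((1 / 2) \<cdot>\<^sub>m 1\<^sub>m m :: real mat)"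
    then have ij: "i < m" "j < m" by auto
    have "(?e + ?o) $$ (i, j) = 1\<^sub>m m $$ (i, j)" unfolding 1 ..
    moreover have "(?e + transpose_mat R\<^sub>o * (- R\<^sub>o)) $$ (i, j) = 0" unfolding 2 using ij by simp
    moreover have "transpose_mat R\<^sub>o * (- R\<^sub>o) = - ?o" using c by simp
    moreover have "?e \<in> carrier_mat m m" "?o \<in> carrier_mat m m" using c by auto
    ultimately show "?e $$ (i, j) = ((1 / 2) \<cdot>\<^sub>m 1\<^sub>m m) $$ (i, j)" using ij by auto
  qed (use c in auto)
qed

lemma smult_mat_mult_vec:
  fixes u :: "'a :: comm_semiring_1 Matrix.vec"
  assumes "A \<in> carrier_mat nr nc" "u \<in> carrier_vec nc"
  shows "(k \<cdot>\<^sub>m A) *\<^sub>v u = k \<cdot>\<^sub>v (A *\<^sub>v u)"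
proof (rule eq_vecI)
  fix i assume "i < dim_vec (k \<cdot>\<^sub>v (A *\<^sub>v u))"
  then have i: "i < nr" using assms by simp
  have "Matrix.row (k \<cdot>\<^sub>m A) i = k \<cdot>\<^sub>v Matrix.row A i"
    using i assms by (intro eq_vecI) auto
  then show "vec_index ((k \<cdot>\<^sub>m A) *\<^sub>v u) i = vec_index (k \<cdot>\<^sub>v (A *\<^sub>v u)) i"
    using i assms smult_scalar_prod_distrib[of "Matrix.row A i" nc u k] by simp
qed (use assms in simp)

text \<open>The relations \<open>M_c M * R\<^sub>o = R\<^sub>e * \<Lambda>\<close> and
  \<open>transpose_mat R\<^sub>e * R\<^sub>e = (1 / 2) \<cdot>\<^sub>m 1\<^sub>m m\<close> reduce
  the form to half of a sum of squares weighted by the positive diagonal of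
  \<open>\<Lambda>\<close>.\<close>

lemma spectral_frame_quadratic_form:
  assumes sf: "spectral_frame M R\<^sub>e R\<^sub>o \<Lambda>" and x: "x \<in> carrier_vec ((M - 1) div 2)"
  shows "0 \<le> scalar_prod (R\<^sub>e *\<^sub>v x) (M_c M *\<^sub>v (R\<^sub>o *\<^sub>v x))"
proof -
  let ?m = "(M - 1) div 2"
  note * = sf[unfolded spectral_frame_def Let_def]
  have c: "R\<^sub>e \<in> carrier_mat ?m ?m" "R\<^sub>o \<in> carrier_mat ?m ?m" "\<Lambda> \<in> carrier_mat ?m ?m"
    and d: "diagonal_mat \<Lambda>" "\<forall>i<?m. \<Lambda> $$ (i, i) > 0" using * by auto
  have cM: "M_c M \<in> carrier_mat ?m ?m" by (auto simp: M_c_def)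
  have Lx: "\<Lambda> *\<^sub>v x \<in> carrier_vec ?m" using c x by auto
  have "M_c M *\<^sub>v (R\<^sub>o *\<^sub>v x) = (M_c M * R\<^sub>o) *\<^sub>v x" using cM c x by simp
  also have "\<dots> = R\<^sub>e *\<^sub>v (\<Lambda> *\<^sub>v x)"
    unfolding spectral_frame_blocks(1)[OF sf] using c x by simp
  finally have "scalar_prod (R\<^sub>e *\<^sub>v x) (M_c M *\<^sub>v (R\<^sub>o *\<^sub>v x)) = scalar_prod (R\<^sub>e *\<^sub>v x) (R\<^sub>e *\<^sub>v (\<Lambda> *\<^sub>v x))" by simp
  also have "\<dots> = scalar_prod x (transpose_mat R\<^sub>e *\<^sub>v (R\<^sub>e *\<^sub>v (\<Lambda> *\<^sub>v x)))"
    using transpose_vec_mult_scalar[of "transpose_mat R\<^sub>e" ?m ?m "R\<^sub>e *\<^sub>v (\<Lambda> *\<^sub>v x)" x] c x Lx by simp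
  also have "transpose_mat R\<^sub>e *\<^sub>v (R\<^sub>e *\<^sub>v (\<Lambda> *\<^sub>v x)) = (transpose_mat R\<^sub>e * R\<^sub>e) *\<^sub>v (\<Lambda> *\<^sub>v x)"
    using c Lx by simp
  also have "\<dots> = (1 / 2) \<cdot>\<^sub>v (\<Lambda> *\<^sub>v x)"
    unfolding spectral_frame_blocks(2)[OF sf] smult_mat_mult_vec[OF one_carrier_mat Lx]
    using Lx by simp
  also have "scalar_prod x \<dots> = 1 / 2 * scalar_prod x (\<Lambda> *\<^sub>v x)" using x Lx by simp
  also have "scalar_prod x (\<Lambda> *\<^sub>v x) = (\<Sum>i<?m. \<Lambda> $$ (i, i) * (vec_index x i)\<^sup>2)"
  proof -
    have "vec_index (\<Lambda> *\<^sub>v x) i = \<Lambda> $$ (i, i) * vec_index x i" if "i < ?m" for i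
    proof -
      have "vec_index (\<Lambda> *\<^sub>v x) i = (\<Sum>j<?m. \<Lambda> $$ (i, j) * vec_index x j)"
        using that c x by (auto simp: scalar_prod_def atLeast0LessThan)
      also have "\<dots> = (\<Sum>j<?m. if j = i then \<Lambda> $$ (i, i) * vec_index x i else 0)"
        using d c that by (intro sum.cong) (auto simp: diagonal_mat_def)
      finally show ?thesis using that by simp
    qed
    then show ?thesis using c unfolding scalar_prod_def
      by (auto intro!: sum.cong simp: atLeast0LessThan power2_eq_square mult_ac simp del: index_mult_mat_vec)
  qed
  also have "1 / 2 * \<dots> \<ge> 0" using d by (auto intro!: mult_nonneg_nonneg sum_nonneg simp: less_imp_le)
  finally show ?thesis .
qed

text \<open>Reading \<open>vCons x\<^sub>0 x\<close> as a block with one entry followed by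
  \<open>x\<close> lets both block matrices inside \<open>H_mat\<close> act blockwise. The vector
  \<open>y\<close> is the image under the first of them, and it later serves as test vector.\<close>

lemma H_mat_mult_vCons:
  fixes x\<^sub>0 :: real
  assumes "R\<^sub>e \<in> carrier_mat m m" "R\<^sub>o \<in> carrier_mat m m" "x \<in> carrier_vec m" and m: "m = (M - 1) div 2" and "odd M"
  defines "y \<equiv> vCons (x\<^sub>0 - scalar_prod (g_tilde M) (R\<^sub>e *\<^sub>v x)) (R\<^sub>e *\<^sub>v x)"
  shows "H_mat M chi R\<^sub>e R\<^sub>o *\<^sub>v vCons x\<^sub>0 x
    = chi_hat chi \<cdot>\<^sub>v (S_c M *\<^sub>v y) + vCons 0 (M_c M *\<^sub>v (R\<^sub>o *\<^sub>v x))"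
proof -
  let ?Q = "four_block_mat (1\<^sub>m 1) (- (mat_of_row (g_tilde M) * R\<^sub>e)) (0\<^sub>m m 1) R\<^sub>e"
  let ?D = "four_block_mat (0\<^sub>m 1 1) (0\<^sub>m 1 m) (0\<^sub>m m 1) (M_c M * R\<^sub>o)"
  have g: "g_tilde M \<in> carrier_vec m" by (simp add: g_tilde_def m)
  have Mc: "M_c M \<in> carrier_mat m m" by (simp add: M_c_def m)
  \<comment> \<open>Oddness of \<open>M\<close> makes the size of \<open>S_c M\<close> agree with
    the block size \<open>1 + m\<close>.\<close>
  have n: "(M + 1) div 2 = Suc m" using \<open>odd M\<close> m by (auto elim!: oddE)
  have S: "S_c M \<in> carrier_mat (Suc m) (Suc m)" by (simp add: S_c_def n[simplified])
  have x0: "vCons x\<^sub>0 vNil \<in> carrier_vec 1" by (rule carrier_vecI) simp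
  have z0: "0\<^sub>m k 1 *\<^sub>v vCons x\<^sub>0 vNil = 0\<^sub>v k" for k
    by (rule eq_vecI) (use x0 in \<open>auto simp: scalar_prod_def\<close>)
  have app: "vCons x\<^sub>0 x = vCons x\<^sub>0 vNil @\<^sub>v x" by simp
  have gR: "mat_of_row (g_tilde M) * R\<^sub>e \<in> carrier_mat 1 m" using g assms by auto
  have "?Q *\<^sub>v vCons x\<^sub>0 x
    = (1\<^sub>m 1 *\<^sub>v vCons x\<^sub>0 vNil + (- (mat_of_row (g_tilde M) * R\<^sub>e)) *\<^sub>v x) @\<^sub>v (0\<^sub>m m 1 *\<^sub>v vCons x\<^sub>0 vNil + R\<^sub>e *\<^sub>v x)"
    unfolding app using gR assms x0 by (intro four_block_mat_mult_vec) auto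
  also have "0\<^sub>m m 1 *\<^sub>v vCons x\<^sub>0 vNil + R\<^sub>e *\<^sub>v x = R\<^sub>e *\<^sub>v x"
    using mult_mat_vec_carrier[OF assms(1,3)] unfolding z0 by simp
  also have "1\<^sub>m 1 *\<^sub>v vCons x\<^sub>0 vNil + (- (mat_of_row (g_tilde M) * R\<^sub>e)) *\<^sub>v x
     = vCons (x\<^sub>0 - scalar_prod (g_tilde M) (R\<^sub>e *\<^sub>v x)) vNil"
  proof -
    have "(- (mat_of_row (g_tilde M) * R\<^sub>e)) *\<^sub>v x = - ((mat_of_row (g_tilde M) * R\<^sub>e) *\<^sub>v x)"
      using gR assms by (intro uminus_mult_mat_vec) auto
    also have "(mat_of_row (g_tilde M) * R\<^sub>e) *\<^sub>v x = mat_of_row (g_tilde M) *\<^sub>v (R\<^sub>e *\<^sub>v x)"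
      using g assms by (intro assoc_mult_mat_vec[of _ 1 m]) auto
    finally show ?thesis
      unfolding one_mult_mat_vec[OF x0] by (intro eq_vecI) (auto simp: vec_index_vCons)
  qed
  finally have Q: "?Q *\<^sub>v vCons x\<^sub>0 x = y" by (simp add: y_def)
  have "?D *\<^sub>v vCons x\<^sub>0 x = (0\<^sub>m 1 1 *\<^sub>v vCons x\<^sub>0 vNil + 0\<^sub>m 1 m *\<^sub>v x) @\<^sub>v (0\<^sub>m m 1 *\<^sub>v vCons x\<^sub>0 vNil + (M_c M * R\<^sub>o) *\<^sub>v x)"
    unfolding app using Mc assms x0 by (intro four_block_mat_mult_vec) auto
  also have "\<dots> = 0\<^sub>v 1 @\<^sub>v (M_c M *\<^sub>v (R\<^sub>o *\<^sub>v x))"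
  proof -
    have "0\<^sub>m 1 m *\<^sub>v x = 0\<^sub>v 1" using assms(3) by (intro eq_vecI) auto
    moreover have "(M_c M * R\<^sub>o) *\<^sub>v x = M_c M *\<^sub>v (R\<^sub>o *\<^sub>v x)" using Mc assms(2,3) by simp
    moreover have "M_c M *\<^sub>v (R\<^sub>o *\<^sub>v x) \<in> carrier_vec m" using Mc assms(2,3) by simp
    ultimately show ?thesis unfolding z0 by simp
  qed
  also have "\<dots> = vCons 0 (M_c M *\<^sub>v (R\<^sub>o *\<^sub>v x))"
    unfolding One_nat_def zero_vec_Suc by simp
  finally have D: "?D *\<^sub>v vCons x\<^sub>0 x = vCons 0 (M_c M *\<^sub>v (R\<^sub>o *\<^sub>v x))" .
  have cQ: "?Q \<in> carrier_mat (Suc m) (Suc m)"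
    using four_block_carrier_mat[of "1\<^sub>m 1" 1 1 R\<^sub>e m m] assms by simp
  have cD: "?D \<in> carrier_mat (Suc m) (Suc m)"
    using four_block_carrier_mat[of "0\<^sub>m 1 1" 1 1 "M_c M * R\<^sub>o" m m] Mc assms by auto
  have cx: "vCons x\<^sub>0 x \<in> carrier_vec (Suc m)" using assms by simp
  have "H_mat M chi R\<^sub>e R\<^sub>o *\<^sub>v vCons x\<^sub>0 x = (chi_hat chi \<cdot>\<^sub>m (S_c M * ?Q)) *\<^sub>v vCons x\<^sub>0 x + ?D *\<^sub>v vCons x\<^sub>0 x"
    unfolding H_mat_def Let_def m[symmetric] using S cQ cD cx by (intro add_mult_distrib_mat_vec) auto
  also have "(chi_hat chi \<cdot>\<^sub>m (S_c M * ?Q)) *\<^sub>v vCons x\<^sub>0 x = chi_hat chi \<cdot>\<^sub>v ((S_c M * ?Q) *\<^sub>v vCons x\<^sub>0 x)"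
    using S cQ cx by (intro smult_mat_mult_vec[of _ "Suc m" "Suc m"]) auto
  also have "(S_c M * ?Q) *\<^sub>v vCons x\<^sub>0 x = S_c M *\<^sub>v y"
    using assoc_mult_mat_vec[OF S cQ cx] Q by simp
  finally show ?thesis unfolding D .
qed

lemma K_coef_pos:
  assumes "odd M" "0 < chi" "chi \<le> 1" and sf: "spectral_frame M R\<^sub>e R\<^sub>o \<Lambda>"
  shows "0 < K_coef M chi R\<^sub>e R\<^sub>o"
proof -
  define m where "m = (M - 1) div 2"
  let ?H = "H_mat M chi R\<^sub>e R\<^sub>o" and ?b = "vCons 1 (g_tilde M)"
  note * = sf[unfolded spectral_frame_def Let_def, folded m_def]
  have R: "R\<^sub>e \<in> carrier_mat m m" "R\<^sub>o \<in> carrier_mat m m" using * by auto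
  have Mc: "M_c M \<in> carrier_mat m m" by (simp add: M_c_def m_def)
  have g: "g_tilde M \<in> carrier_vec m" by (simp add: g_tilde_def m_def)
  have n: "(M + 1) div 2 = Suc m" using \<open>odd M\<close> m_def by (auto elim!: oddE)
  have S: "S_c M \<in> carrier_mat (Suc m) (Suc m)" by (simp add: S_c_def n[simplified])
  have chi: "0 < chi_hat chi" using assms by (auto simp: chi_hat_def intro!: divide_pos_pos mult_pos_pos)
  have H: "?H \<in> carrier_mat (Suc m) (Suc m)"
    using four_block_carrier_mat[of "0\<^sub>m 1 1" 1 1 "M_c M * R\<^sub>o" m m] Mc R
    unfolding H_mat_def Let_def m_def[symmetric] by auto
  \<comment> \<open>The test vector is the one multiplied by \<open>chi_hat chi\<close> times
    \<open>S_c M\<close> in \<open>?H *\<^sub>v x\<close>. In its product with \<open>?b\<close> the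
    two occurrences of \<open>g_tilde M\<close> cancel and leave the first entry of
    \<open>x\<close>. The claim is used twice: for the invertibility of \<open>?H\<close> and for
    the sign of \<open>K_coef\<close>.\<close>
  have key: "\<exists>y \<in> carrier_vec (Suc m). 0 < scalar_prod y (?H *\<^sub>v x) \<and> scalar_prod y ?b = vec_index x 0"
    if x: "x \<in> carrier_vec (Suc m)" "x \<noteq> 0\<^sub>v (Suc m)" for x
  proof -
    obtain x0 x' where xx: "x = vCons x0 x'" and x': "x' \<in> carrier_vec m"
      using x(1) by (cases x) auto
    define y where "y = vCons (x0 - scalar_prod (g_tilde M) (R\<^sub>e *\<^sub>v x')) (R\<^sub>e *\<^sub>v x')"
    have Rx: "R\<^sub>e *\<^sub>v x' \<in> carrier_vec m" using R x' by simp
    have y: "y \<in> carrier_vec (Suc m)" using Rx by (simp add: y_def)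
    have My: "M_c M *\<^sub>v (R\<^sub>o *\<^sub>v x') \<in> carrier_vec m" using Mc R x' by simp
    \<comment> \<open>The map from \<open>x\<close> to \<open>y\<close> is block upper triangular:
      invertibility of \<open>R\<^sub>e\<close> first forces \<open>x' = 0\<close>, and then
      \<open>x0 = 0\<close>.\<close>
    have y0: "y \<noteq> 0\<^sub>v (Suc m)"
    proof
      assume "y = 0\<^sub>v (Suc m)"
      then have 0: "R\<^sub>e *\<^sub>v x' = 0\<^sub>v m" "x0 = scalar_prod (g_tilde M) (R\<^sub>e *\<^sub>v x')"
        by (auto simp: y_def zero_vec_Suc)
      obtain B where "B * R\<^sub>e = 1\<^sub>m m" "B \<in> carrier_mat m m"
        using * R by (metis carrier_matD invertible_mat_def inverts_mat_def carrier_matI index_mult_mat(2,3) index_one_mat(2,3))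
      then have "x' = B *\<^sub>v (R\<^sub>e *\<^sub>v x')"
        using R x' by (metis assoc_mult_mat_vec one_mult_mat_vec)
      also have "\<dots> = 0\<^sub>v m" using \<open>B \<in> carrier_mat m m\<close> unfolding 0 by (intro eq_vecI) auto
      finally have "x' = 0\<^sub>v m" .
      moreover have "x0 = 0" using 0 g by simp
      ultimately show False using x(2) by (simp add: xx zero_vec_Suc)
    qed
    have Sy: "S_c M *\<^sub>v y \<in> carrier_vec (Suc m)" using S y by simp
    have "scalar_prod y (?H *\<^sub>v x) = scalar_prod y (chi_hat chi \<cdot>\<^sub>v (S_c M *\<^sub>v y)) + scalar_prod y (vCons 0 (M_c M *\<^sub>v (R\<^sub>o *\<^sub>v x')))"
      unfolding xx H_mat_mult_vCons[OF R x' m_def \<open>odd M\<close>] y_def[symmetric]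
      using y Sy My by (intro scalar_prod_add_distrib[of _ "Suc m"]) auto
    also have "\<dots> = chi_hat chi * scalar_prod y (S_c M *\<^sub>v y) + scalar_prod (R\<^sub>e *\<^sub>v x') (M_c M *\<^sub>v (R\<^sub>o *\<^sub>v x'))"
      using y Sy by (simp add: scalar_prod_smult_distrib[of _ "Suc m"]) (simp add: y_def)
    also have "\<dots> > 0"
      using S_c_positive_definite[of y M] y y0 n chi spectral_frame_quadratic_form[OF sf, of x'] x'
      by (intro add_pos_nonneg mult_pos_pos) (auto simp: m_def)
    finally have "0 < scalar_prod y (?H *\<^sub>v x)" .
    moreover have "scalar_prod y ?b = vec_index x 0"
      using Rx g comm_scalar_prod[OF Rx g] by (simp add: y_def xx)
    ultimately show ?thesis using y by blast
  qed
  \<comment> \<open>A nonzero kernel vector would make the strictly positive product in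
    \<open>key\<close> vanish. Hence \<open>mat_inverse\<close> returns \<open>Some\<close>, and the
    \<open>the\<close> in \<open>K_coef\<close> denotes a genuine inverse.\<close>
  have "Determinant.det ?H \<noteq> 0"
  proof
    assume "Determinant.det ?H = 0"
    then obtain x where "x \<in> carrier_vec (Suc m)" "x \<noteq> 0\<^sub>v (Suc m)" "?H *\<^sub>v x = 0\<^sub>v (Suc m)"
      using det_0_iff_vec_prod_zero[OF H] by blast
    then show False using key[of x] by auto
  qed
  then obtain B where B: "mat_inverse ?H = Some B" "?H * B = 1\<^sub>m (Suc m)" "B \<in> carrier_mat (Suc m) (Suc m)"
    using det_non_zero_imp_unit[OF H] mat_inverse[OF H] by (metis not_None_eq)
  have b: "?b \<in> carrier_vec (Suc m)" using g by simp
  define x where "x = B *\<^sub>v ?b"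
  have x: "x \<in> carrier_vec (Suc m)" using B b by (simp add: x_def)
  have Hx: "?H *\<^sub>v x = ?b" using assoc_mult_mat_vec[OF H B(3) b] B b by (simp add: x_def)
  have "x \<noteq> 0\<^sub>v (Suc m)"
  proof
    assume "x = 0\<^sub>v (Suc m)"
    moreover have "?H *\<^sub>v 0\<^sub>v (Suc m) = 0\<^sub>v (Suc m)" using H by (intro eq_vecI) auto
    ultimately have "?b = 0\<^sub>v (Suc m)" using Hx by simp
    then show False by (simp add: zero_vec_Suc)
  qed
  from key[OF x this] have "0 < vec_index x 0" unfolding Hx by auto
  then show ?thesis by (simp add: K_coef_def B x_def)
qed

section \<open>Energy estimate for the Robin problem\<close>

lemma continuous_on_slice_right:
  assumes "continuous_on (I \<times> S) (\<lambda>(t, x). g t x)" and "t \<in> I"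
  shows "continuous_on S (g t)"
proof -
  have "continuous_on S (\<lambda>x. (t, x))" by (intro continuous_intros)
  moreover have "(\<lambda>x. (t, x)) ` S \<subseteq> I \<times> S" using assms(2) by auto
  ultimately show ?thesis using continuous_on_compose2[OF assms(1)] by fastforce
qed

lemma continuous_on_slice_left:
  assumes "continuous_on (I \<times> S) (\<lambda>(t, x). g t x)" and "x \<in> S"
  shows "continuous_on I (\<lambda>t. g t x)"
proof -
  have "continuous_on I (\<lambda>t. (t, x))" by (intro continuous_intros)
  moreover have "(\<lambda>t. (t, x)) ` I \<subseteq> I \<times> S" using assms(2) by auto
  ultimately show ?thesis using continuous_on_compose2[OF assms(1)] by fastforce
qed

text \<open>Here \<open>p\<close> stands for the cutoff, \<open>q\<close> for its derivative, and
  the bracket for the derivative of \<open>p\<^sup>2 * w * w1\<close>. Completing the square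
  \<open>(p * w1 + q * w)\<^sup>2\<close> lets the dissipation absorb the commutator up to
  \<open>q\<^sup>2 * w\<^sup>2\<close>; Young's inequality handles the source.\<close>

lemma weighted_energy_inequality_pointwise:
  fixes p q w w1 w2 f \<epsilon> B :: real
  assumes "0 \<le> \<epsilon>" "\<bar>p\<bar> \<le> 1" "\<bar>w\<bar> \<le> B"
  shows "2 * p\<^sup>2 * w * (\<epsilon> * w2 + f)
    \<le> 2 * \<epsilon> * (2 * p * q * w * w1 + p\<^sup>2 * w1\<^sup>2 + p\<^sup>2 * w * w2) + 2 * \<epsilon> * (q\<^sup>2 * B\<^sup>2) + f\<^sup>2 + p\<^sup>2 * w\<^sup>2"
proof -
  have "w\<^sup>2 \<le> B\<^sup>2" using assms(3) by (simp add: abs_le_square_iff[symmetric])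
  then have "q\<^sup>2 * w\<^sup>2 \<le> q\<^sup>2 * B\<^sup>2" by (simp add: mult_left_mono)
  then have "\<epsilon> * (q\<^sup>2 * w\<^sup>2) \<le> \<epsilon> * (q\<^sup>2 * B\<^sup>2)" using assms(1) by (rule mult_left_mono)
  moreover have "0 \<le> \<epsilon> * (p * w1 + q * w)\<^sup>2" using assms(1) by simp
  moreover have "2 * p\<^sup>2 * w * f \<le> f\<^sup>2 + p\<^sup>2 * w\<^sup>2"
  proof -
    have "p\<^sup>2 \<le> 1" using assms(2) by (simp add: abs_square_le_1)
    then have "p\<^sup>2 * f\<^sup>2 \<le> 1 * f\<^sup>2" by (rule mult_right_mono) simp
    moreover have "0 \<le> p\<^sup>2 * (f - w)\<^sup>2" by simp
    ultimately show ?thesis by (simp add: power2_eq_square algebra_simps)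
  qed
  ultimately show ?thesis by (simp add: power2_eq_square algebra_simps)
qed

text \<open>Integration of the pointwise inequality with cutoff \<open>1 - x / L\<close>. Its zero
  at \<open>L\<close> removes the outer flux, so only the flux at \<open>a\<close> survives, and
  \<open>w\<close> needs no decay.\<close>

lemma cutoff_energy_rate:
  fixes w w1 w2 f :: "real \<Rightarrow> real" and \<epsilon> B L N a :: real
  assumes "0 \<le> \<epsilon>" "0 \<le> a" "a \<le> L" "0 < L"
    and w: "\<And>x. x \<in> {a..L} \<Longrightarrow> (w has_real_derivative w1 x) (at x within {a..L})"
    and w1: "\<And>x. x \<in> {a..L} \<Longrightarrow> (w1 has_real_derivative w2 x) (at x within {a..L})"
    and f: "continuous_on {a..L} f" and w2: "continuous_on {a..L} w2"
    and B: "\<And>x. x \<in> {a..L} \<Longrightarrow> \<bar>w x\<bar> \<le> B"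
    and N: "integral {a..L} (\<lambda>x. (f x)\<^sup>2) \<le> N"
  shows "integral {a..L} (\<lambda>x. 2 * (1 - x / L)\<^sup>2 * w x * (\<epsilon> * w2 x + f x))
    \<le> 2 * \<epsilon> * B\<^sup>2 / L + N + integral {a..L} (\<lambda>x. (1 - x / L)\<^sup>2 * (w x)\<^sup>2)
      - 2 * \<epsilon> * (1 - a / L)\<^sup>2 * w a * w1 a"
proof -
  have cw: "continuous_on {a..L} w" and cw1: "continuous_on {a..L} w1"
    using w w1 by (meson DERIV_continuous continuous_on_eq_continuous_within)+
  note cont = cw cw1 w2 f
  let ?d = "\<lambda>x. 2 * (1 - x / L) * (- 1 / L) * w x * w1 x + (1 - x / L)\<^sup>2 * (w1 x)\<^sup>2 + (1 - x / L)\<^sup>2 * w x * w2 x"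
  let ?P = "\<lambda>x. (1 - x / L)\<^sup>2 * w x * w1 x"
  have "(?P has_real_derivative ?d x) (at x within {a..L})" if "x \<in> {a..L}" for x
  proof -
    have "((\<lambda>x. 1 - x / L) has_real_derivative (- 1 / L)) (at x within {a..L})"
      using \<open>0 < L\<close> by (auto intro!: derivative_eq_intros)
    from DERIV_mult[OF DERIV_mult[OF DERIV_power[OF this, of 2] w[OF that]] w1[OF that]]
    show ?thesis by (rule DERIV_cong) (simp add: power2_eq_square algebra_simps)
  qed
  then have I1: "(?d has_integral (?P L - ?P a)) {a..L}"
    using \<open>a \<le> L\<close> by (intro fundamental_theorem_of_calculus) (auto simp: has_real_derivative_iff_has_vector_derivative)
  have I2: "((\<lambda>x. 2 * \<epsilon> * ((- 1 / L)\<^sup>2 * B\<^sup>2)) has_integral (L - a) * (2 * \<epsilon> * ((- 1 / L)\<^sup>2 * B\<^sup>2))) {a..L}"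
    using has_integral_const_real[of "2 * \<epsilon> * ((- 1 / L)\<^sup>2 * B\<^sup>2)" a L] \<open>a \<le> L\<close> by simp
  have I3: "((\<lambda>x. (f x)\<^sup>2) has_integral integral {a..L} (\<lambda>x. (f x)\<^sup>2)) {a..L}"
    by (intro integrable_integral integrable_continuous_interval continuous_intros cont)
  have I4: "((\<lambda>x. (1 - x / L)\<^sup>2 * (w x)\<^sup>2) has_integral integral {a..L} (\<lambda>x. (1 - x / L)\<^sup>2 * (w x)\<^sup>2)) {a..L}"
    using \<open>0 < L\<close> by (intro integrable_integral integrable_continuous_interval continuous_intros cont) auto
  have I5: "((\<lambda>x. 2 * (1 - x / L)\<^sup>2 * w x * (\<epsilon> * w2 x + f x)) has_integral
     integral {a..L} (\<lambda>x. 2 * (1 - x / L)\<^sup>2 * w x * (\<epsilon> * w2 x + f x))) {a..L}"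
    using \<open>0 < L\<close> by (intro integrable_integral integrable_continuous_interval continuous_intros cont) auto
  have "integral {a..L} (\<lambda>x. 2 * (1 - x / L)\<^sup>2 * w x * (\<epsilon> * w2 x + f x))
     \<le> 2 * \<epsilon> * (?P L - ?P a) + (L - a) * (2 * \<epsilon> * ((- 1 / L)\<^sup>2 * B\<^sup>2))
       + integral {a..L} (\<lambda>x. (f x)\<^sup>2) + integral {a..L} (\<lambda>x. (1 - x / L)\<^sup>2 * (w x)\<^sup>2)"
  proof (rule has_integral_le[OF I5])
    show "((\<lambda>x. 2 * \<epsilon> * ?d x + 2 * \<epsilon> * ((- 1 / L)\<^sup>2 * B\<^sup>2) + (f x)\<^sup>2 + (1 - x / L)\<^sup>2 * (w x)\<^sup>2) has_integral
      2 * \<epsilon> * (?P L - ?P a) + (L - a) * (2 * \<epsilon> * ((- 1 / L)\<^sup>2 * B\<^sup>2))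
       + integral {a..L} (\<lambda>x. (f x)\<^sup>2) + integral {a..L} (\<lambda>x. (1 - x / L)\<^sup>2 * (w x)\<^sup>2)) {a..L}"
      by (intro has_integral_add I2 I3 I4 has_integral_mult_right I1)
    fix x assume x: "x \<in> {a..L}"
    then have "\<bar>1 - x / L\<bar> \<le> 1" using \<open>0 \<le> a\<close> \<open>0 < L\<close> by (simp add: abs_le_iff)
    from weighted_energy_inequality_pointwise[OF \<open>0 \<le> \<epsilon>\<close> this B[OF x], of "w2 x" "f x" "- 1 / L" "w1 x"]
    show "2 * (1 - x / L)\<^sup>2 * w x * (\<epsilon> * w2 x + f x)
      \<le> 2 * \<epsilon> * ?d x + 2 * \<epsilon> * ((- 1 / L)\<^sup>2 * B\<^sup>2) + (f x)\<^sup>2 + (1 - x / L)\<^sup>2 * (w x)\<^sup>2" by simp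
  qed
  \<comment> \<open>The squared slope \<open>1 / L\<^sup>2\<close> of the cutoff is integrated over
    a length of at most \<open>L\<close>, which leaves a commutator of order
    \<open>1 / L\<close>.\<close>
  moreover have "(L - a) * (2 * \<epsilon> * ((- 1 / L)\<^sup>2 * B\<^sup>2)) \<le> 2 * \<epsilon> * B\<^sup>2 / L"
  proof -
    have "(L - a) * (2 * \<epsilon> * ((- 1 / L)\<^sup>2 * B\<^sup>2)) \<le> L * (2 * \<epsilon> * ((- 1 / L)\<^sup>2 * B\<^sup>2))"
      using assms(1,2) by (intro mult_right_mono) auto
    also have "\<dots> = 2 * \<epsilon> * B\<^sup>2 / L" using \<open>0 < L\<close> by (simp add: power2_eq_square)
    finally show ?thesis .
  qed
  moreover have "2 * \<epsilon> * (?P L - ?P a) = - (2 * \<epsilon> * (1 - a / L)\<^sup>2 * w a * w1 a)"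
    using \<open>0 < L\<close> by simp
  ultimately show ?thesis using N by linarith
qed

text \<open>The content of \<open>bounded_classical\<close> with the derivatives as parameters, which makes linear
  combinations and rescalings easy.\<close>

locale classical_function =
  fixes T B :: real and v vt vx vxx :: "real \<Rightarrow> real \<Rightarrow> real"
  assumes cont_v: "continuous_on ({0..T} \<times> {0..}) (\<lambda>(t, x). v t x)"
    and bound: "t \<in> {0..T} \<Longrightarrow> 0 \<le> x \<Longrightarrow> \<bar>v t x\<bar> \<le> B"
    and deriv_x: "t \<in> {0<..T} \<Longrightarrow> 0 \<le> x \<Longrightarrow> (v t has_real_derivative vx t x) (at x within {0..})"
    and cont_vx: "continuous_on ({0<..T} \<times> {0..}) (\<lambda>(t, x). vx t x)"
    and deriv_t: "t \<in> {0<..T} \<Longrightarrow> 0 < x \<Longrightarrow> ((\<lambda>s. v s x) has_real_derivative vt t x) (at t within {0..T})"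
    and cont_vt: "continuous_on ({0<..T} \<times> {0<..}) (\<lambda>(t, x). vt t x)"
    and deriv_xx: "t \<in> {0<..T} \<Longrightarrow> 0 < x \<Longrightarrow> (vx t has_real_derivative vxx t x) (at x within {0..})"
    and cont_vxx: "continuous_on ({0<..T} \<times> {0<..}) (\<lambda>(t, x). vxx t x)"
begin

text \<open>Young's inequality leaves a copy of \<open>E t\<close> on the right, which the
  integrating factor \<open>exp (- t)\<close> absorbs. Since \<open>0 < a\<close> and
  \<open>0 < s\<close>, the function \<open>vt\<close> is continuous on the compact rectangle, so
  differentiation under the integral sign is justified.\<close>

lemma energy_inequality_truncated:
  assumes "0 \<le> \<epsilon>" "0 < a" "a \<le> L" "0 < s" "s \<le> \<tau>" "\<tau> \<le> T"
    and N: "\<And>t. t \<in> {0<..T} \<Longrightarrow> integral {a..L} (\<lambda>x. (vt t x - \<epsilon> * vxx t x)\<^sup>2) \<le> N"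
  defines "E \<equiv> \<lambda>t. integral {a..L} (\<lambda>x. (1 - x / L)\<^sup>2 * (v t x)\<^sup>2)"
  shows "exp (- \<tau>) * E \<tau> - exp (- s) * E s
    \<le> integral {s..\<tau>} (\<lambda>t. exp (- t) * (2 * \<epsilon> * B\<^sup>2 / L + N - 2 * \<epsilon> * (1 - a / L)\<^sup>2 * v t a * vx t a))"
proof -
  have L: "0 < L" using assms by simp
  have sub: "{s..\<tau>} \<subseteq> {0<..T}" "{s..\<tau>} \<subseteq> {0..T}" using assms by auto
  have cv: "continuous_on ({s..\<tau>} \<times> {a..L}) (\<lambda>(t, x). v t x)"
    and cvt: "continuous_on ({s..\<tau>} \<times> {a..L}) (\<lambda>(t, x). vt t x)"
    using assms by (auto intro: continuous_on_subset[OF cont_v] continuous_on_subset[OF cont_vt])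
  have E': "(E has_real_derivative integral {a..L} (\<lambda>x. (1 - x / L)\<^sup>2 * (2 * v t x * vt t x))) (at t within {s..\<tau>})"
    if t: "t \<in> {s..\<tau>}" for t
    unfolding E_def interval_cbox[of a L]
  proof (rule leibniz_rule_field_derivative[OF _ _ _ t])
    fix r x assume r: "r \<in> {s..\<tau>}" and x: "x \<in> cbox a L"
    have "((\<lambda>s. v s x) has_real_derivative vt r x) (at r within {s..\<tau>})"
      using deriv_t[of r x] r x sub assms by (auto intro: DERIV_subset)
    then show "((\<lambda>s. (1 - x / L)\<^sup>2 * (v s x)\<^sup>2) has_real_derivative (1 - x / L)\<^sup>2 * (2 * v r x * vt r x)) (at r within {s..\<tau>})"
      by (auto intro!: derivative_eq_intros)
  next
    fix r assume "r \<in> {s..\<tau>}"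
    then show "(\<lambda>x. (1 - x / L)\<^sup>2 * (v r x)\<^sup>2) integrable_on cbox a L"
      unfolding cbox_interval using continuous_on_slice_right[OF cv] L
      by (intro integrable_continuous_interval continuous_intros) auto
  next
    show "continuous_on ({s..\<tau>} \<times> cbox a L) (\<lambda>(r, x). (1 - x / L)\<^sup>2 * (2 * v r x * vt r x))"
      using cv cvt L unfolding cbox_interval split_beta by (intro continuous_intros) auto
  qed simp
  let ?G = "\<lambda>t. exp (- t) * E t"
  let ?G' = "\<lambda>t. exp (- t) * (integral {a..L} (\<lambda>x. (1 - x / L)\<^sup>2 * (2 * v t x * vt t x)) - E t)"
  have "(?G' has_integral ?G \<tau> - ?G s) {s..\<tau>}"
  proof (rule fundamental_theorem_of_calculus[OF \<open>s \<le> \<tau>\<close>])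
    fix t assume "t \<in> {s..\<tau>}"
    then show "(?G has_vector_derivative ?G' t) (at t within {s..\<tau>})"
      unfolding has_real_derivative_iff_has_vector_derivative[symmetric]
      by (auto intro!: derivative_eq_intros E' simp: algebra_simps)
  qed
  moreover have "((\<lambda>t. exp (- t) * (2 * \<epsilon> * B\<^sup>2 / L + N - 2 * \<epsilon> * (1 - a / L)\<^sup>2 * v t a * vx t a)) has_integral
      integral {s..\<tau>} (\<lambda>t. exp (- t) * (2 * \<epsilon> * B\<^sup>2 / L + N - 2 * \<epsilon> * (1 - a / L)\<^sup>2 * v t a * vx t a))) {s..\<tau>}"
  proof -
    have "continuous_on {s..\<tau>} (\<lambda>t. v t a)" "continuous_on {s..\<tau>} (\<lambda>t. vx t a)"
      using continuous_on_slice_left[OF cont_v, of a] continuous_on_slice_left[OF cont_vx, of a]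
        \<open>0 < a\<close> sub by (simp_all add: continuous_on_subset)
    then show ?thesis
      by (intro integrable_integral integrable_continuous_interval continuous_intros)
  qed
  ultimately show ?thesis
  proof (rule has_integral_le)
    fix t assume "t \<in> {s..\<tau>}"
    then have t: "t \<in> {0<..T}" "t \<in> {0..T}" using sub by auto
    \<comment> \<open>The time derivative is split into \<open>\<epsilon> * vxx t x\<close> and the
      residual of the heat equation, which takes the role of the source.\<close>
    have "integral {a..L} (\<lambda>x. 2 * (1 - x / L)\<^sup>2 * v t x * (\<epsilon> * vxx t x + (vt t x - \<epsilon> * vxx t x)))
      \<le> 2 * \<epsilon> * B\<^sup>2 / L + N + integral {a..L} (\<lambda>x. (1 - x / L)\<^sup>2 * (v t x)\<^sup>2)
        - 2 * \<epsilon> * (1 - a / L)\<^sup>2 * v t a * vx t a"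
    proof (rule cutoff_energy_rate[OF \<open>0 \<le> \<epsilon>\<close> _ \<open>a \<le> L\<close> L])
      show "continuous_on {a..L} (vxx t)"
        by (rule continuous_on_subset[OF continuous_on_slice_right[OF cont_vxx t(1)]]) (use \<open>0 < a\<close> in auto)
      moreover have "continuous_on {a..L} (vt t)"
        by (rule continuous_on_subset[OF continuous_on_slice_right[OF cont_vt t(1)]]) (use \<open>0 < a\<close> in auto)
      ultimately show "continuous_on {a..L} (\<lambda>x. vt t x - \<epsilon> * vxx t x)"
        by (intro continuous_intros)
      show "(v t has_real_derivative vx t x) (at x within {a..L})" if "x \<in> {a..L}" for x
        using deriv_x[OF t(1), of x] that assms by (auto intro: DERIV_subset)
      show "(vx t has_real_derivative vxx t x) (at x within {a..L})" if "x \<in> {a..L}" for x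
        using deriv_xx[OF t(1), of x] that assms by (auto intro: DERIV_subset)
      show "\<bar>v t x\<bar> \<le> B" if "x \<in> {a..L}" for x using bound[OF t(2), of x] that assms by auto
    qed (use N t assms in auto)
    then have "integral {a..L} (\<lambda>x. (1 - x / L)\<^sup>2 * (2 * v t x * vt t x)) - E t
       \<le> 2 * \<epsilon> * B\<^sup>2 / L + N - 2 * \<epsilon> * (1 - a / L)\<^sup>2 * v t a * vx t a"
      by (simp add: E_def mult_ac)
    then show "?G' t \<le> exp (- t) * (2 * \<epsilon> * B\<^sup>2 / L + N - 2 * \<epsilon> * (1 - a / L)\<^sup>2 * v t a * vx t a)"
      by (intro mult_left_mono) auto
  qed
qed

text \<open>The limit \<open>a \<rightarrow> 0\<close>. Only \<open>v\<close> and \<open>vx\<close>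
  occur in the inequality itself, and they are continuous up to \<open>x = 0\<close>;
  \<open>vt\<close> and \<open>vxx\<close> enter through the bound \<open>N\<close>, which is
  uniform in \<open>a\<close>.\<close>

lemma energy_inequality:
  assumes "0 \<le> \<epsilon>" "0 < L" "0 < s" "s \<le> \<tau>" "\<tau> \<le> T"
    and N: "\<And>t a. t \<in> {0<..T} \<Longrightarrow> 0 < a \<Longrightarrow> integral {a..L} (\<lambda>x. (vt t x - \<epsilon> * vxx t x)\<^sup>2) \<le> N"
  defines "E \<equiv> \<lambda>t. integral {0..L} (\<lambda>x. (1 - x / L)\<^sup>2 * (v t x)\<^sup>2)"
  shows "exp (- \<tau>) * E \<tau> - exp (- s) * E s
    \<le> integral {s..\<tau>} (\<lambda>t. exp (- t) * (2 * \<epsilon> * B\<^sup>2 / L + N - 2 * \<epsilon> * v t 0 * vx t 0))"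
proof -
  let ?E = "\<lambda>a t. integral {a..L} (\<lambda>x. (1 - x / L)\<^sup>2 * (v t x)\<^sup>2)"
  let ?r = "\<lambda>a t. exp (- t) * (2 * \<epsilon> * B\<^sup>2 / L + N - 2 * \<epsilon> * (1 - a / L)\<^sup>2 * v t a * vx t a)"
  \<comment> \<open>The right side minus the left side: nonnegative for \<open>0 < a < L\<close> and
    continuous on \<open>{0..L}\<close>, hence nonnegative at \<open>0\<close>.\<close>
  define \<Phi> where "\<Phi> = (\<lambda>a. integral {s..\<tau>} (?r a) - (exp (- \<tau>) * ?E a \<tau> - exp (- s) * ?E a s))"
  \<comment> \<open>Continuity of a parametric integral expects the parameter, here
    \<open>a\<close>, as first coordinate.\<close>
  have swap: "continuous_on ({0..L} \<times> {s..\<tau>}) (\<lambda>z. case prod.swap z of (t, x) \<Rightarrow> g t x)"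
    if "continuous_on ({0<..T} \<times> {0..}) (\<lambda>(t, x). g t x)" for g :: "real \<Rightarrow> real \<Rightarrow> real"
    using assms by (intro continuous_on_compose2[OF that] continuous_on_swap) auto
  have cE: "continuous_on {0..L} (\<lambda>a. ?E a t)" if "t \<in> {0..T}" for t
  proof -
    have "continuous_on {0..L} (v t)"
      by (rule continuous_on_subset[OF continuous_on_slice_right[OF cont_v that]]) auto
    then have "(\<lambda>x. (1 - x / L)\<^sup>2 * (v t x)\<^sup>2) integrable_on {0..L}"
      using \<open>0 < L\<close> by (intro integrable_continuous_interval continuous_intros) auto
    then show ?thesis by (rule indefinite_integral_continuous_1')
  qed
  have "continuous_on ({0<..T} \<times> {0..}) (\<lambda>(t, x). v t x)"
    by (rule continuous_on_subset[OF cont_v]) auto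
  from swap[OF this] swap[OF cont_vx]
  have "continuous_on {0..L} (\<lambda>a. integral (cbox s \<tau>) (?r a))"
    using \<open>0 < L\<close> by (intro integral_continuous_on_param) (auto simp: split_beta intro!: continuous_intros)
  then have "continuous_on {0..L} \<Phi>"
    unfolding \<Phi>_def using assms cE by (intro continuous_intros) auto
  from continuous_on_Icc_at_rightD[OF this \<open>0 < L\<close>] have "(\<Phi> \<longlongrightarrow> \<Phi> 0) (at_right 0)" .
  moreover have "eventually (\<lambda>a. 0 \<le> \<Phi> a) (at_right 0)"
    unfolding eventually_at_right_field
  proof (intro exI[of _ L] conjI allI impI \<open>0 < L\<close>)
    fix a assume "0 < a" "a < L"
    then show "0 \<le> \<Phi> a"
      unfolding \<Phi>_def using energy_inequality_truncated[of \<epsilon> a L s \<tau> N] assms by simp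
  qed
  ultimately have "0 \<le> \<Phi> 0" by (intro tendsto_lowerbound[of \<Phi> "\<Phi> 0" "at_right 0"]) auto
  then show ?thesis by (simp add: \<Phi>_def E_def)
qed

text \<open>The Robin datum replaces the flux by a good boundary term, and then
  \<open>s \<rightarrow> 0\<close>. The limit is needed because nothing is known about
  \<open>vx\<close> at \<open>t = 0\<close>; the initial energy vanishes with the initial
  data.\<close>

lemma robin_energy_inequality:
  assumes "0 < \<epsilon>" "0 < K" "0 < L" "0 \<le> \<tau>" "\<tau> \<le> T" and zero: "\<And>x. 0 \<le> x \<Longrightarrow> v 0 x = 0"
    and N: "\<And>t a. t \<in> {0<..T} \<Longrightarrow> 0 < a \<Longrightarrow> integral {a..L} (\<lambda>x. (vt t x - \<epsilon> * vxx t x)\<^sup>2) \<le> N"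
    and P: "\<And>s. 0 < s \<Longrightarrow> s \<le> \<tau> \<Longrightarrow> integral {s..\<tau>} (\<lambda>t. (v t 0 - \<epsilon> * K * vx t 0)\<^sup>2) \<le> P"
    and "0 \<le> N" "0 \<le> P"
  shows "exp (- T) * integral {0..L} (\<lambda>x. (1 - x / L)\<^sup>2 * (v \<tau> x)\<^sup>2) + exp (- T) / K * integral {0..\<tau>} (\<lambda>t. (v t 0)\<^sup>2)
    \<le> T * (2 * \<epsilon> * B\<^sup>2 / L + N) + P / K"
proof (cases "\<tau> = 0")
  case True
  then have "integral {0..L} (\<lambda>x. (1 - x / L)\<^sup>2 * (v \<tau> x)\<^sup>2) = integral {0..L} (\<lambda>x. 0)"
    by (intro integral_cong) (simp add: zero)
  then show ?thesis using True assms by simp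
next
  case False
  then have "0 < \<tau>" using assms by simp
  define E where "E = (\<lambda>t. integral {0..L} (\<lambda>x. (1 - x / L)\<^sup>2 * (v t x)\<^sup>2))"
  define D where "D = 2 * \<epsilon> * B\<^sup>2 / L + N"
  have "0 \<le> D" using assms by (simp add: D_def)
  have cv0: "continuous_on {0..T} (\<lambda>t. v t 0)" by (rule continuous_on_slice_left[OF cont_v]) simp
  have cvx0: "continuous_on {0<..T} (\<lambda>t. vx t 0)" by (rule continuous_on_slice_left[OF cont_vx]) simp
  have "continuous_on {0..\<tau>} (\<lambda>t. integral (cbox 0 L) (\<lambda>x. (1 - x / L)\<^sup>2 * (v t x)\<^sup>2))"
  proof (rule integral_continuous_on_param)
    have "continuous_on ({0..\<tau>} \<times> cbox 0 L) (\<lambda>(t, x). v t x)"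
      using assms by (auto intro!: continuous_on_subset[OF cont_v])
    then show "continuous_on ({0..\<tau>} \<times> cbox 0 L) (\<lambda>(t, x). (1 - x / L)\<^sup>2 * (v t x)\<^sup>2)"
      using \<open>0 < L\<close> unfolding split_beta by (intro continuous_intros) auto
  qed
  then have cE: "continuous_on {0..\<tau>} E" by (simp add: E_def)
  have E0: "E 0 = 0"
  proof -
    have "E 0 = integral {0..L} (\<lambda>x. 0)" unfolding E_def by (intro integral_cong) (simp add: zero)
    then show ?thesis by simp
  qed
  \<comment> \<open>The flux is eliminated before the limit: \<open>\<Psi>\<close> contains
    \<open>v\<close> only, which is continuous down to \<open>t = 0\<close>.\<close>
  define \<Psi> where "\<Psi> = (\<lambda>s. exp (- \<tau>) * E \<tau> - exp (- s) * E s + exp (- T) / K * integral {s..\<tau>} (\<lambda>t. (v t 0)\<^sup>2))"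
  have "\<Psi> s \<le> T * D + P / K" if s: "0 < s" "s < \<tau>" for s
  proof -
    have sub: "{s..\<tau>} \<subseteq> {0..T}" "{s..\<tau>} \<subseteq> {0<..T}" using s assms by auto
    have c: "continuous_on {s..\<tau>} (\<lambda>t. v t 0)" "continuous_on {s..\<tau>} (\<lambda>t. vx t 0)"
      using continuous_on_subset[OF cv0 sub(1)] continuous_on_subset[OF cvx0 sub(2)] .
    let ?\<beta> = "\<lambda>t. v t 0 - \<epsilon> * K * vx t 0"
    have "exp (- \<tau>) * E \<tau> - exp (- s) * E s
        \<le> integral {s..\<tau>} (\<lambda>t. exp (- t) * (2 * \<epsilon> * B\<^sup>2 / L + N - 2 * \<epsilon> * v t 0 * vx t 0))"
      unfolding E_def using assms s by (intro energy_inequality) auto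
    also have "\<dots> \<le> (\<tau> - s) * D + integral {s..\<tau>} (\<lambda>t. (?\<beta> t)\<^sup>2) * (1 / K) - exp (- T) / K * integral {s..\<tau>} (\<lambda>t. (v t 0)\<^sup>2)"
    proof (rule has_integral_le)
      show "((\<lambda>t. exp (- t) * (2 * \<epsilon> * B\<^sup>2 / L + N - 2 * \<epsilon> * v t 0 * vx t 0)) has_integral
         integral {s..\<tau>} (\<lambda>t. exp (- t) * (2 * \<epsilon> * B\<^sup>2 / L + N - 2 * \<epsilon> * v t 0 * vx t 0))) {s..\<tau>}"
        by (intro integrable_integral integrable_continuous_interval continuous_intros c)
      show "((\<lambda>t. D + (?\<beta> t)\<^sup>2 * (1 / K) - exp (- T) / K * (v t 0)\<^sup>2) has_integral
         (\<tau> - s) * D + integral {s..\<tau>} (\<lambda>t. (?\<beta> t)\<^sup>2) * (1 / K) - exp (- T) / K * integral {s..\<tau>} (\<lambda>t. (v t 0)\<^sup>2)) {s..\<tau>}"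
      proof (intro has_integral_diff has_integral_add has_integral_mult_left has_integral_mult_right)
        show "((\<lambda>t. D) has_integral (\<tau> - s) * D) {s..\<tau>}"
          using has_integral_const_real[of D s \<tau>] s by simp
      qed (intro integrable_integral integrable_continuous_interval continuous_intros c)+
      fix t assume t: "t \<in> {s..\<tau>}"
      \<comment> \<open>The Robin combination \<open>?\<beta> t\<close> is solved for
        \<open>\<epsilon> * vx t 0\<close>; dividing by \<open>K > 0\<close> preserves the sign of
        the dissipative term.\<close>
      have "- 2 * \<epsilon> * v t 0 * vx t 0 = (2 * v t 0 * ?\<beta> t - 2 * (v t 0)\<^sup>2) / K"
        using \<open>0 < K\<close> by (simp add: field_simps power2_eq_square)
      also have "\<dots> \<le> ((?\<beta> t)\<^sup>2 - (v t 0)\<^sup>2) / K"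
      proof (rule divide_right_mono)
        have "0 \<le> (?\<beta> t - v t 0)\<^sup>2" by simp
        then show "2 * v t 0 * ?\<beta> t - 2 * (v t 0)\<^sup>2 \<le> (?\<beta> t)\<^sup>2 - (v t 0)\<^sup>2"
          by (simp add: power2_eq_square algebra_simps)
      qed (use \<open>0 < K\<close> in simp)
      finally have "D - 2 * \<epsilon> * v t 0 * vx t 0 \<le> D + (?\<beta> t)\<^sup>2 / K - (v t 0)\<^sup>2 / K"
        by (simp add: diff_divide_distrib)
      then have "exp (- t) * (D - 2 * \<epsilon> * v t 0 * vx t 0) \<le> exp (- t) * (D + (?\<beta> t)\<^sup>2 / K - (v t 0)\<^sup>2 / K)"
        by (intro mult_left_mono) auto
      also have "\<dots> = exp (- t) * (D + (?\<beta> t)\<^sup>2 / K) - exp (- t) * ((v t 0)\<^sup>2 / K)"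
        by (simp add: algebra_simps)
      \<comment> \<open>The factor \<open>exp (- t)\<close> is bounded above by \<open>1\<close> on
        the data terms and below by \<open>exp (- T)\<close> on the term to be kept.\<close>
      also have "\<dots> \<le> 1 * (D + (?\<beta> t)\<^sup>2 / K) - exp (- T) * ((v t 0)\<^sup>2 / K)"
        using t sub \<open>0 \<le> D\<close> \<open>0 < K\<close> by (intro diff_mono mult_right_mono) auto
      finally show "exp (- t) * (2 * \<epsilon> * B\<^sup>2 / L + N - 2 * \<epsilon> * v t 0 * vx t 0)
         \<le> D + (?\<beta> t)\<^sup>2 * (1 / K) - exp (- T) / K * (v t 0)\<^sup>2"
        by (simp add: D_def)
    qed
    also have "\<dots> \<le> T * D + P * (1 / K) - exp (- T) / K * integral {s..\<tau>} (\<lambda>t. (v t 0)\<^sup>2)"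
      using P[of s] s assms \<open>0 \<le> D\<close> by (intro diff_mono add_mono mult_right_mono order_refl) auto
    finally show ?thesis by (simp add: \<Psi>_def)
  qed
  moreover have "(\<Psi> \<longlongrightarrow> \<Psi> 0) (at_right 0)"
  proof (rule continuous_on_Icc_at_rightD[OF _ \<open>0 < \<tau>\<close>])
    have "continuous_on {0..\<tau>} (\<lambda>t. v t 0)"
      by (rule continuous_on_subset[OF cv0]) (use assms in auto)
    then have "continuous_on {0..\<tau>} (\<lambda>s. integral {s..\<tau>} (\<lambda>t. (v t 0)\<^sup>2))"
      by (intro indefinite_integral_continuous_1' integrable_continuous_interval continuous_on_power)
    then show "continuous_on {0..\<tau>} \<Psi>" unfolding \<Psi>_def by (intro continuous_intros cE)
  qed
  ultimately have "\<Psi> 0 \<le> T * D + P / K"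
    using \<open>0 < \<tau>\<close> by (intro tendsto_upperbound[of \<Psi> "\<Psi> 0" "at_right 0"]) (auto simp: eventually_at_right_field)
  moreover have "exp (- T) * E \<tau> \<le> exp (- \<tau>) * E \<tau>"
  proof (rule mult_right_mono)
    have "continuous_on {0..L} (v \<tau>)"
      by (rule continuous_on_subset[OF continuous_on_slice_right[OF cont_v]]) (use assms in auto)
    then have "(\<lambda>x. (1 - x / L)\<^sup>2 * (v \<tau> x)\<^sup>2) integrable_on {0..L}"
      using \<open>0 < L\<close> by (intro integrable_continuous_interval continuous_intros) auto
    then show "0 \<le> E \<tau>" unfolding E_def by (rule integral_nonneg) simp
  qed (use assms in simp)
  ultimately show ?thesis unfolding \<Psi>_def E0 D_def by (simp add: E_def)
qed

text \<open>The limit \<open>L \<rightarrow> \<infinity>\<close> with \<open>l\<close> fixed. On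
  \<open>{0..l}\<close> the weight is at least \<open>(1 - l / L)\<^sup>2\<close>, which tends to
  \<open>1\<close>, while the commutator tends to \<open>0\<close>.\<close>

lemma robin_energy_bound:
  assumes "0 < \<epsilon>" "0 < K" "0 \<le> \<tau>" "\<tau> \<le> T" and zero: "\<And>x. 0 \<le> x \<Longrightarrow> v 0 x = 0"
    and N: "\<And>t a L. t \<in> {0<..T} \<Longrightarrow> 0 < a \<Longrightarrow> integral {a..L} (\<lambda>x. (vt t x - \<epsilon> * vxx t x)\<^sup>2) \<le> N"
    and P: "\<And>s. 0 < s \<Longrightarrow> s \<le> \<tau> \<Longrightarrow> integral {s..\<tau>} (\<lambda>t. (v t 0 - \<epsilon> * K * vx t 0)\<^sup>2) \<le> P"
    and "0 \<le> N" "0 \<le> P" "0 < l"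
  shows "exp (- T) * integral {0..l} (\<lambda>x. (v \<tau> x)\<^sup>2) + exp (- T) / K * integral {0..\<tau>} (\<lambda>t. (v t 0)\<^sup>2)
    \<le> T * N + P / K"
proof -
  let ?I = "integral {0..l} (\<lambda>x. (v \<tau> x)\<^sup>2)" and ?J = "integral {0..\<tau>} (\<lambda>t. (v t 0)\<^sup>2)"
  have cv: "continuous_on {0..c} (v \<tau>)" for c
    by (rule continuous_on_subset[OF continuous_on_slice_right[OF cont_v]]) (use assms in auto)
  have "exp (- T) * ((1 - l / L)\<^sup>2 * ?I) + exp (- T) / K * ?J \<le> T * (2 * \<epsilon> * B\<^sup>2 / L + N) + P / K" if L: "l < L" for L
  proof -
    have "0 < L" using L assms by simp
    have i: "(\<lambda>x. (1 - x / L)\<^sup>2 * (v \<tau> x)\<^sup>2) integrable_on {0..c}" for c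
      using \<open>0 < L\<close> by (intro integrable_continuous_interval continuous_intros cv) auto
    have "(1 - l / L)\<^sup>2 * ?I = integral {0..l} (\<lambda>x. (1 - l / L)\<^sup>2 * (v \<tau> x)\<^sup>2)" by simp
    also have "\<dots> \<le> integral {0..l} (\<lambda>x. (1 - x / L)\<^sup>2 * (v \<tau> x)\<^sup>2)"
    proof (rule integral_le[OF _ i])
      show "(\<lambda>x. (1 - l / L)\<^sup>2 * (v \<tau> x)\<^sup>2) integrable_on {0..l}"
        by (intro integrable_continuous_interval continuous_intros cv)
      fix x assume "x \<in> {0..l}"
      then have "1 - l / L \<le> 1 - x / L" "0 \<le> 1 - l / L" using L \<open>0 < L\<close> by (auto simp: divide_right_mono)
      then show "(1 - l / L)\<^sup>2 * (v \<tau> x)\<^sup>2 \<le> (1 - x / L)\<^sup>2 * (v \<tau> x)\<^sup>2"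
        by (intro mult_right_mono power_mono) auto
    qed
    also have "\<dots> \<le> integral {0..L} (\<lambda>x. (1 - x / L)\<^sup>2 * (v \<tau> x)\<^sup>2)"
      using L by (intro integral_subset_le i) auto
    finally have "exp (- T) * ((1 - l / L)\<^sup>2 * ?I) \<le> exp (- T) * integral {0..L} (\<lambda>x. (1 - x / L)\<^sup>2 * (v \<tau> x)\<^sup>2)"
      by (intro mult_left_mono) auto
    moreover have "exp (- T) * integral {0..L} (\<lambda>x. (1 - x / L)\<^sup>2 * (v \<tau> x)\<^sup>2) + exp (- T) / K * ?J
       \<le> T * (2 * \<epsilon> * B\<^sup>2 / L + N) + P / K"
      using assms \<open>0 < L\<close> by (intro robin_energy_inequality) auto
    ultimately show ?thesis by linarith
  qed
  then have "eventually (\<lambda>L. exp (- T) * ((1 - l / L)\<^sup>2 * ?I) + exp (- T) / K * ?J \<le> T * (2 * \<epsilon> * B\<^sup>2 / L + N) + P / K) at_top"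
    using eventually_gt_at_top[of l] by (rule eventually_mono[rotated])
  moreover have "((\<lambda>L. exp (- T) * ((1 - l / L)\<^sup>2 * ?I) + exp (- T) / K * ?J) \<longlongrightarrow> exp (- T) * ((1 - 0)\<^sup>2 * ?I) + exp (- T) / K * ?J) at_top"
    by (intro tendsto_intros real_tendsto_divide_at_top[OF tendsto_const] filterlim_ident)
  moreover have "((\<lambda>L. T * (2 * \<epsilon> * B\<^sup>2 / L + N) + P / K) \<longlongrightarrow> T * (0 + N) + P / K) at_top"
    by (intro tendsto_intros real_tendsto_divide_at_top[OF tendsto_const] filterlim_ident)
  ultimately have "exp (- T) * ((1 - 0)\<^sup>2 * ?I) + exp (- T) / K * ?J \<le> T * (0 + N) + P / K"
    using tendsto_le[OF trivial_limit_at_top_linorder] by blast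
  then show ?thesis by simp
qed

end

text \<open>Monotone convergence along the intervals \<open>{0..real n}\<close>: nonnegativity makes
  the truncated integrals increase, and their bounded limit is the integral over the half
  line.\<close>

lemma set_integrable_atLeast_of_bounded_integrals:
  fixes g :: "real \<Rightarrow> real"
  assumes "continuous_on {0..} g" and "\<And>x. 0 \<le> x \<Longrightarrow> 0 \<le> g x"
    and bnd: "\<And>l. 0 < l \<Longrightarrow> integral {0..l} g \<le> Q"
  shows "set_integrable lborel {0..} g" and "set_lebesgue_integral lborel {0..} g \<le> Q"
proof -
  let ?f = "\<lambda>n x. indicat_real {0..real n} x *\<^sub>R g x"
  have c: "continuous_on {0..real n} g" for n using assms(1) by (rule continuous_on_subset) auto
  have int: "integrable lborel (?f n)" for n
    using borel_integrable_atLeastAtMost'[OF c] by (simp add: set_integrable_def)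
  have eq: "integral\<^sup>L lborel (?f n) = integral {0..real n} g" for n
    using set_borel_integral_eq_integral(2)[OF borel_integrable_atLeastAtMost'[OF c]]
    by (simp add: set_lebesgue_integral_def)
  have mono: "mono (\<lambda>n. ?f n x)" for x
    using assms(2)[of x] by (auto simp: mono_def indicator_def)
  \<comment> \<open>\<open>max Q 0\<close> covers \<open>n = 0\<close>, where \<open>bnd\<close>
    says nothing and the integral is zero.\<close>
  have "integral\<^sup>L lborel (?f n) \<le> max Q 0" for n
    using bnd[of "real n"] unfolding eq by (cases "n = 0") auto
  moreover have "incseq (\<lambda>n. integral\<^sup>L lborel (?f n))"
    using int mono by (auto simp: incseq_def mono_def intro!: integral_mono)
  ultimately obtain q where q: "(\<lambda>n. integral\<^sup>L lborel (?f n)) \<longlonglongrightarrow> q"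
    by (meson incseq_convergent)
  have lim: "(\<lambda>n. ?f n x) \<longlonglongrightarrow> indicat_real {0..} x *\<^sub>R g x" for x
  proof (rule tendsto_eventually)
    obtain k where "x \<le> real k" using real_arch_simple by blast
    then show "eventually (\<lambda>n. ?f n x = indicat_real {0..} x *\<^sub>R g x) sequentially"
      by (intro eventually_sequentiallyI[of k]) (auto simp: indicator_def)
  qed
  have meas: "(\<lambda>x. indicat_real {0..} x *\<^sub>R g x) \<in> borel_measurable lborel"
    using borel_measurable_continuous_on_indicator[OF _ assms(1)] by simp
  note mc = integral_monotone_convergence_nonneg[OF int _ _ _ q meas]
  show "set_integrable lborel {0..} g"
    unfolding set_integrable_def by (rule mc) (use mono lim assms(2) in \<open>auto simp: indicator_def\<close>)
  have "set_lebesgue_integral lborel {0..} g = q"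
    unfolding set_lebesgue_integral_def by (rule mc) (use mono lim assms(2) in \<open>auto simp: indicator_def\<close>)
  moreover have "q \<le> Q"
    by (rule LIMSEQ_le_const2[OF q]) (auto simp: eq simp del: real_scaleR_def intro!: exI[of _ 1] bnd)
  ultimately show "set_lebesgue_integral lborel {0..} g \<le> Q" by simp
qed


text \<open>If the square is not integrable, \<open>integral\<close> has the default value
  \<open>0\<close>.\<close>

lemma integral_nonneg_power2: "0 \<le> integral S (\<lambda>x. (g x :: real)\<^sup>2)"
  by (cases "(\<lambda>x. (g x)\<^sup>2) integrable_on S") (auto intro: integral_nonneg simp: not_integrable_integral)

text \<open>Both norms come from the same energy bound by dropping the other nonnegative term: the
  interior norm at time \<open>\<tau>\<close>, the boundary norm at the final time \<open>T\<close>.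
  Clearing the factors \<open>exp (- T)\<close> and \<open>1 / K\<close> produces the
  constants.\<close>

lemma (in classical_function) robin_L2_estimate:
  assumes "0 < T" "0 < \<epsilon>" "0 < K" and zero: "\<And>x. 0 \<le> x \<Longrightarrow> v 0 x = 0"
    and N: "\<And>t a L. t \<in> {0<..T} \<Longrightarrow> 0 < a \<Longrightarrow> integral {a..L} (\<lambda>x. (vt t x - \<epsilon> * vxx t x)\<^sup>2) \<le> N"
    and P: "\<And>s \<tau>. 0 < s \<Longrightarrow> \<tau> \<le> T \<Longrightarrow> integral {s..\<tau>} (\<lambda>t. (v t 0 - \<epsilon> * K * vx t 0)\<^sup>2) \<le> P"
    and "\<tau> \<in> {0..T}"
  shows "square_integrable_on {0..} (v \<tau>)" and "L2_sq {0..} (v \<tau>) \<le> exp T * (T * N + P / K)"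
    and "square_integrable_on {0..T} (\<lambda>s. v s 0)" and "L2_sq {0..T} (\<lambda>s. v s 0) \<le> K * (exp T * (T * N + P / K))"
proof -
  \<comment> \<open>The signs of \<open>N\<close> and \<open>P\<close> follow from degenerate
    intervals, whose integrals are zero.\<close>
  have "0 \<le> N" using N[of T 1 1] \<open>0 < T\<close> by simp
  have "0 \<le> P" using P[of T T] \<open>0 < T\<close> by simp
  have est: "exp (- T) * integral {0..l} (\<lambda>x. (v \<tau> x)\<^sup>2) + exp (- T) / K * integral {0..\<tau>} (\<lambda>t. (v t 0)\<^sup>2)
    \<le> T * N + P / K" if "0 < l" "\<tau> \<in> {0..T}" for l \<tau>
    using that assms \<open>0 \<le> N\<close> \<open>0 \<le> P\<close> by (intro robin_energy_bound[of \<epsilon>]) auto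
  have c: "continuous_on {0..} (v \<tau>)" using cont_v \<open>\<tau> \<in> {0..T}\<close> by (rule continuous_on_slice_right)
  have bnd: "integral {0..l} (\<lambda>x. (v \<tau> x)\<^sup>2) \<le> exp T * (T * N + P / K)" if "0 < l" for l
  proof -
    have "0 \<le> exp (- T) / K * integral {0..\<tau>} (\<lambda>t. (v t 0)\<^sup>2)"
      using \<open>0 < K\<close> by (intro mult_nonneg_nonneg integral_nonneg_power2) auto
    then have "exp (- T) * integral {0..l} (\<lambda>x. (v \<tau> x)\<^sup>2) \<le> T * N + P / K"
      using est[OF that assms(7)] by linarith
    then have "exp T * (exp (- T) * integral {0..l} (\<lambda>x. (v \<tau> x)\<^sup>2)) \<le> exp T * (T * N + P / K)"
      by (intro mult_left_mono) auto
    then show ?thesis by (simp add: exp_minus field_simps)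
  qed
  show "square_integrable_on {0..} (v \<tau>)" "L2_sq {0..} (v \<tau>) \<le> exp T * (T * N + P / K)"
    unfolding square_integrable_on_def L2_sq_def
    using set_integrable_atLeast_of_bounded_integrals[OF continuous_on_power[OF c] _ bnd] by simp_all
  have "continuous_on {0..T} (\<lambda>s. v s 0)" using cont_v by (rule continuous_on_slice_left) simp
  then have si: "set_integrable lborel {0..T} (\<lambda>s. (v s 0)\<^sup>2)"
    by (intro borel_integrable_atLeastAtMost' continuous_on_power)
  then show "square_integrable_on {0..T} (\<lambda>s. v s 0)" by (simp add: square_integrable_on_def)
  have "0 \<le> exp (- T) * integral {0..1} (\<lambda>x. (v T x)\<^sup>2)"
    by (intro mult_nonneg_nonneg integral_nonneg_power2) auto
  then have "exp (- T) / K * integral {0..T} (\<lambda>t. (v t 0)\<^sup>2) \<le> T * N + P / K"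
    using est[of 1 T] \<open>0 < T\<close> by simp
  then have "K * exp T * (exp (- T) / K * integral {0..T} (\<lambda>t. (v t 0)\<^sup>2)) \<le> K * exp T * (T * N + P / K)"
    using \<open>0 < K\<close> by (intro mult_left_mono) auto
  then have "integral {0..T} (\<lambda>t. (v t 0)\<^sup>2) \<le> K * (exp T * (T * N + P / K))"
    using \<open>0 < K\<close> by (simp add: exp_minus field_simps)
  then show "L2_sq {0..T} (\<lambda>s. v s 0) \<le> K * (exp T * (T * N + P / K))"
    unfolding L2_sq_def set_borel_integral_eq_integral(2)[OF si] .
qed

section \<open>Linear combinations, rescaling and partial derivatives of classical functions\<close>

lemma classical_function_add:
  assumes "classical_function T B v vt vx vxx" "classical_function T B' w wt wx wxx"
  shows "classical_function T (B + B') (\<lambda>t x. v t x + w t x) (\<lambda>t x. vt t x + wt t x)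
    (\<lambda>t x. vx t x + wx t x) (\<lambda>t x. vxx t x + wxx t x)"
proof -
  interpret v: classical_function T B v vt vx vxx by fact
  interpret w: classical_function T B' w wt wx wxx by fact
  show ?thesis
  proof
    show "\<bar>v t x + w t x\<bar> \<le> B + B'" if "t \<in> {0..T}" "0 \<le> x" for t x
      using v.bound[OF that] w.bound[OF that] by linarith
  qed (auto simp: split_beta intro!: continuous_on_add DERIV_add v.deriv_x w.deriv_x v.deriv_t w.deriv_t
      v.deriv_xx w.deriv_xx v.cont_v[unfolded split_beta] w.cont_v[unfolded split_beta]
      v.cont_vx[unfolded split_beta] w.cont_vx[unfolded split_beta] v.cont_vt[unfolded split_beta]
      w.cont_vt[unfolded split_beta] v.cont_vxx[unfolded split_beta] w.cont_vxx[unfolded split_beta])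
qed

lemma classical_function_cmult:
  assumes "classical_function T B v vt vx vxx"
  shows "classical_function T (\<bar>c\<bar> * B) (\<lambda>t x. c * v t x) (\<lambda>t x. c * vt t x)
    (\<lambda>t x. c * vx t x) (\<lambda>t x. c * vxx t x)"
proof -
  interpret v: classical_function T B v vt vx vxx by fact
  show ?thesis
    by standard
      (auto simp: split_beta abs_mult intro!: continuous_on_mult_left DERIV_cmult mult_left_mono
        v.bound v.deriv_x v.deriv_t v.deriv_xx v.cont_v[unfolded split_beta]
        v.cont_vx[unfolded split_beta] v.cont_vt[unfolded split_beta] v.cont_vxx[unfolded split_beta])
qed

text \<open>This passes from the layer variable \<open>y = x / c\<close> to \<open>x\<close>, with
  \<open>c = sqrt \<epsilon>\<close> in the application. One-sided derivatives survive because
  division by \<open>c > 0\<close> maps the half line into itself.\<close>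

lemma classical_function_rescale:
  assumes "classical_function T B v vt vx vxx" "0 < c"
  shows "classical_function T B (\<lambda>t x. v t (x / c)) (\<lambda>t x. vt t (x / c))
    (\<lambda>t x. vx t (x / c) / c) (\<lambda>t x. vxx t (x / c) / c\<^sup>2)"
proof -
  interpret v: classical_function T B v vt vx vxx by fact
  have cont: "continuous_on (I \<times> S) (\<lambda>(t, x). g t (x / c))"
    if "continuous_on (I \<times> S) (\<lambda>(t, x). g t x)" "\<And>x. x \<in> S \<Longrightarrow> x / c \<in> S"
    for g :: "real \<Rightarrow> real \<Rightarrow> real" and I S
  proof -
    have "continuous_on (I \<times> S) (\<lambda>z. (fst z, snd z / c))" using \<open>0 < c\<close> by (intro continuous_intros) auto
    moreover have "(\<lambda>z. (fst z, snd z / c)) ` (I \<times> S) \<subseteq> I \<times> S" using that(2) by auto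
    ultimately show ?thesis using continuous_on_compose2[OF that(1)] by (fastforce simp: split_beta)
  qed
  have chain: "((\<lambda>x. g (x / c)) has_real_derivative g' / c) (at x within {0..})"
    if "(g has_real_derivative g') (at (x / c) within {0..})" for g :: "real \<Rightarrow> real" and g' x
  proof -
    have "(\<lambda>x. x / c) ` {0..} \<subseteq> {0..}" using \<open>0 < c\<close> by auto
    then have "(g has_real_derivative g') (at (x / c) within (\<lambda>x. x / c) ` {0..})"
      using that by (rule DERIV_subset[rotated])
    moreover have "((\<lambda>x. x / c) has_real_derivative 1 / c) (at x within {0..})"
      by (intro DERIV_cdivide DERIV_ident)
    ultimately show ?thesis using DERIV_image_chain[of g g' "\<lambda>x. x / c" x "{0..}" "1 / c"] by (simp add: o_def)
  qed
  show ?thesis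
  proof
    show "continuous_on ({0..T} \<times> {0..}) (\<lambda>(t, x). v t (x / c))"
      using \<open>0 < c\<close> by (intro cont v.cont_v) auto
    have "continuous_on ({0<..T} \<times> {0..}) (\<lambda>(t, x). vx t (x / c))"
      using \<open>0 < c\<close> by (intro cont v.cont_vx) auto
    then show "continuous_on ({0<..T} \<times> {0..}) (\<lambda>(t, x). vx t (x / c) / c)"
      using \<open>0 < c\<close> unfolding split_beta by (intro continuous_intros) auto
    show "continuous_on ({0<..T} \<times> {0<..}) (\<lambda>(t, x). vt t (x / c))"
      using \<open>0 < c\<close> by (intro cont v.cont_vt) auto
    have "continuous_on ({0<..T} \<times> {0<..}) (\<lambda>(t, x). vxx t (x / c))"
      using \<open>0 < c\<close> by (intro cont v.cont_vxx) auto
    then show "continuous_on ({0<..T} \<times> {0<..}) (\<lambda>(t, x). vxx t (x / c) / c\<^sup>2)"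
      using \<open>0 < c\<close> unfolding split_beta by (intro continuous_intros) auto
    fix t x :: real assume t: "t \<in> {0<..T}" and x: "0 < x"
    then have "0 < x / c" using \<open>0 < c\<close> by simp
    then show "((\<lambda>s. v s (x / c)) has_real_derivative vt t (x / c)) (at t within {0..T})"
      using t by (rule v.deriv_t[rotated])
    from DERIV_cdivide[OF chain[OF v.deriv_xx[OF t \<open>0 < x / c\<close>]], of c]
    show "((\<lambda>x. vx t (x / c) / c) has_real_derivative vxx t (x / c) / c\<^sup>2) (at x within {0..})"
      by (simp add: power2_eq_square)
  next
    fix t x :: real assume "t \<in> {0<..T}" "0 \<le> x"
    then show "((\<lambda>x. v t (x / c)) has_real_derivative vx t (x / c) / c) (at x within {0..})"
      using \<open>0 < c\<close> by (intro chain v.deriv_x) auto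
  next
    fix t x :: real assume "t \<in> {0..T}" "0 \<le> x"
    then show "\<bar>v t (x / c)\<bar> \<le> B" using \<open>0 < c\<close> by (intro v.bound) auto
  qed
qed

text \<open>A second point \<open>y\<close> makes \<open>x\<close> a limit point of the connected
  set \<open>S\<close>, so the derivative within \<open>S\<close> is unique and the choice in
  \<open>vector_derivative\<close> is determined.\<close>

lemma vector_derivative_within_connected:
  fixes f :: "real \<Rightarrow> real"
  assumes "(f has_real_derivative D) (at x within S)" "connected S" "x \<in> S" "y \<in> S" "y \<noteq> x"
  shows "vector_derivative f (at x within S) = D"
proof (rule vector_derivative_within)
  have "x islimpt S" using assms by (intro connected_imp_perfect) auto
  then show "at x within S \<noteq> bot" by (simp add: trivial_limit_within)
qed (use assms in \<open>simp add: has_real_derivative_iff_has_vector_derivative\<close>)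

context classical_function
begin

lemma partial_t_eq:
  assumes "t \<in> {0<..T}" "0 < x"
  shows "partial_t T v t x = vt t x"
  unfolding partial_t_def ddt_def using assms
  by (intro vector_derivative_within_connected[OF deriv_t, where y = 0]) auto

lemma partial_x_eq:
  assumes "t \<in> {0<..T}" "0 \<le> x"
  shows "partial_x v t x = vx t x"
  unfolding partial_x_def using assms
  by (intro vector_derivative_within_connected[OF deriv_x, where y = "x + 1"]) auto

lemma partial_xx_eq:
  assumes "t \<in> {0<..T}" "0 < x"
  shows "partial_x (partial_x v) t x = vxx t x"
proof -
  \<comment> \<open>\<open>partial_x v t\<close> and \<open>vx t\<close> agree on the whole half
    line within which the derivative is taken, so any radius, here \<open>1\<close>, serves for the
    transfer.\<close>
  have "(partial_x v t has_real_derivative vxx t x) (at x within {0..})"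
    by (rule has_field_derivative_transform_within[OF deriv_xx[OF assms], of 1])
       (use assms in \<open>auto simp: partial_x_eq\<close>)
  then show ?thesis unfolding partial_x_def[of "partial_x v"] using assms
    by (intro vector_derivative_within_connected[where y = "x + 1"]) auto
qed

end

lemma bounded_classicalE:
  assumes "bounded_classical T u"
  obtains B where "classical_function T B u (partial_t T u) (partial_x u) (partial_x (partial_x u))"
proof -
  note * = assms[unfolded bounded_classical_def differentiable_t_def differentiable_x_def]
  have bd: "bounded ((\<lambda>(t, x). u t x) ` ({0..T} \<times> {0..}))"
    and dx: "\<forall>t\<in>{0<..T}. \<forall>x\<ge>0. u t differentiable (at x within {0..})"
    and dt: "\<forall>t\<in>{0<..T}. \<forall>x>0. (\<lambda>s. u s x) differentiable (at t within {0..T})"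
    and dxx: "\<forall>t\<in>{0<..T}. \<forall>x>0. partial_x u t differentiable (at x within {0..})"
    using * by - (elim conjE, assumption)+
  obtain B where B: "\<forall>y\<in>(\<lambda>(t, x). u t x) ` ({0..T} \<times> {0..}). norm y \<le> B"
    using bd unfolding bounded_iff by (elim exE)
  have "classical_function T B u (partial_t T u) (partial_x u) (partial_x (partial_x u))"
  proof
    show "\<bar>u t x\<bar> \<le> B" if "t \<in> {0..T}" "0 \<le> x" for t x
    proof -
      have "u t x \<in> (\<lambda>(t, x). u t x) ` ({0..T} \<times> {0..})"
        using that by (intro image_eqI[of _ _ "(t, x)"]) auto
      then show ?thesis using B by auto
    qed
    show "(u t has_real_derivative partial_x u t x) (at x within {0..})" if "t \<in> {0<..T}" "0 \<le> x" for t x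
      using dx[rule_format, OF that] unfolding partial_x_def has_real_derivative_iff_has_vector_derivative
      by (simp only: vector_derivative_works)
    show "(partial_x u t has_real_derivative partial_x (partial_x u) t x) (at x within {0..})"
      if "t \<in> {0<..T}" "0 < x" for t x
      using dxx[rule_format, OF that] unfolding partial_x_def[of "partial_x u"] has_real_derivative_iff_has_vector_derivative
      by (simp only: vector_derivative_works)
    show "((\<lambda>s. u s x) has_real_derivative partial_t T u t x) (at t within {0..T})"
      if "t \<in> {0<..T}" "0 < x" for t x
      using dt[rule_format, OF that] unfolding partial_t_def ddt_def has_real_derivative_iff_has_vector_derivative
      by (simp only: vector_derivative_works)
  qed (insert *, (elim conjE, assumption)+)
  then show thesis by (rule that)
qed

text \<open>The derivatives may stay anonymous: \<open>R_ns\<close> and \<open>b_ns\<close> apply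
  the derivative operators to the composite \<open>u_ns_a\<close>, and these are identified with the
  locale parameters where they are used.\<close>

lemma classical_u_ns_a:
  assumes "bounded_classical T u0" "bounded_classical T u1" "bounded_classical T u2" "0 < \<epsilon>"
  obtains B pt px pxx where "classical_function T B (u_ns_a u0 u1 u2 \<epsilon>) pt px pxx"
proof -
  obtain B0 B1 B2 where
    "classical_function T B0 u0 (partial_t T u0) (partial_x u0) (partial_x (partial_x u0))"
    "classical_function T B1 u1 (partial_t T u1) (partial_x u1) (partial_x (partial_x u1))"
    "classical_function T B2 u2 (partial_t T u2) (partial_x u2) (partial_x (partial_x u2))"
    using assms(1-3) by (metis bounded_classicalE)
  note r = this[THEN classical_function_rescale, of "sqrt \<epsilon>"]
  have "0 < sqrt \<epsilon>" using assms(4) by simp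
  note r = r[OF this]
  note c = classical_function_add[OF classical_function_add[OF r(1) classical_function_cmult[OF r(2), of "sqrt \<epsilon>"]]
      classical_function_cmult[OF r(3), of \<epsilon>]]
  have "u_ns_a u0 u1 u2 \<epsilon> = (\<lambda>t x. u0 t (x / sqrt \<epsilon>) + sqrt \<epsilon> * u1 t (x / sqrt \<epsilon>) + \<epsilon> * u2 t (x / sqrt \<epsilon>))"
    by (intro ext) (simp add: u_ns_a_def)
  then show thesis using c by (intro that) simp
qed

section \<open>From the residual bounds to the convergence rate\<close>

lemma integral_subset_le_L2_sq:
  assumes "square_integrable_on S g" "{a..b} \<subseteq> S"
  shows "integral {a..b} (\<lambda>x. (g x)\<^sup>2) \<le> L2_sq S g"
proof -
  note i = set_borel_integral_eq_integral[OF assms(1)[unfolded square_integrable_on_def]]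
  have "(\<lambda>x. (g x)\<^sup>2) integrable_on {a..b}" using i(1) assms(2) by (rule integrable_on_subinterval)
  then show ?thesis unfolding L2_sq_def i(2) using i(1) assms(2) by (intro integral_subset_le) auto
qed

lemma L2_sq_nonneg: "0 \<le> L2_sq S g"
  unfolding L2_sq_def set_lebesgue_integral_def by (intro Bochner_Integration.integral_nonneg) simp

text \<open>Power count: the squared source contributes
  \<open>\<epsilon>\<^sup>2 * (C * sqrt \<epsilon>)\<close> and the squared boundary residual
  \<open>\<epsilon> ^ 3 * C\<close>. Both are at most \<open>C * \<epsilon> powr (5 / 2)\<close>,
  and the square root gives the rate.\<close>

lemma ns_error_estimate:
  assumes "0 < T" "0 < K" and \<epsilon>: "\<epsilon> \<in> {0<..1}" "ns_solution T K J \<epsilon> uw u"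
    and ua: "classical_function T B ua pt px pxx" and ua0: "\<And>x. 0 \<le> x \<Longrightarrow> ua 0 x = 0"
    and R: "\<And>t. t \<in> {0..T} \<Longrightarrow> square_integrable_on {0<..} (\<lambda>x. R_ns T \<epsilon> ua t (x / sqrt \<epsilon>))"
      "\<And>t. t \<in> {0..T} \<Longrightarrow> L2_sq {0<..} (\<lambda>x. R_ns T \<epsilon> ua t (x / sqrt \<epsilon>)) \<le> C * sqrt \<epsilon>"
    and b: "square_integrable_on {0..T} (b_ns T K J \<epsilon> uw ua)" "L2_sq {0..T} (b_ns T K J \<epsilon> uw ua) \<le> C"
    and t: "t \<in> {0..T}"
  defines "A \<equiv> exp T * (C * (T + 1 / K))"
  shows "square_integrable_on {0..} (\<lambda>x. u t x - ua t x)"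
    and "square_integrable_on {0..T} (\<lambda>s. u s 0 - ua s 0)"
    and "sqrt (L2_sq {0..} (\<lambda>x. u t x - ua t x)) + sqrt (L2_sq {0..T} (\<lambda>s. u s 0 - ua s 0))
      \<le> (sqrt A + sqrt (K * A)) * \<epsilon> powr (5 / 4)"
proof -
  have "0 < \<epsilon>" "\<epsilon> \<le> 1" using \<epsilon>(1) by auto
  note ns = \<epsilon>(2)[unfolded ns_solution_def zero_initial_def heat_equation_def]
  interpret ua: classical_function T B ua pt px pxx by fact
  obtain B' where u: "classical_function T B' u (partial_t T u) (partial_x u) (partial_x (partial_x u))"
    using ns bounded_classicalE by metis
  let ?v = "\<lambda>t x. u t x - ua t x"
  let ?vt = "\<lambda>t x. partial_t T u t x - pt t x"
  let ?vx = "\<lambda>t x. partial_x u t x - px t x"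
  let ?vxx = "\<lambda>t x. partial_x (partial_x u) t x - pxx t x"
  interpret v: classical_function T "B' + \<bar>- 1\<bar> * B" ?v ?vt ?vx ?vxx
    using classical_function_add[OF u classical_function_cmult[OF ua, of "- 1"]] by simp
  define N where "N = \<epsilon>\<^sup>2 * (C * sqrt \<epsilon>)"
  define P where "P = \<epsilon> ^ 3 * C"
  have N: "integral {a..L} (\<lambda>x. (?vt t x - \<epsilon> * ?vxx t x)\<^sup>2) \<le> N" if "t \<in> {0<..T}" "0 < a" for t a L
  proof -
    have "integral {a..L} (\<lambda>x. (?vt t x - \<epsilon> * ?vxx t x)\<^sup>2) = integral {a..L} (\<lambda>x. \<epsilon>\<^sup>2 * (R_ns T \<epsilon> ua t (x / sqrt \<epsilon>))\<^sup>2)"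
    proof (rule integral_cong)
      fix x assume "x \<in> {a..L}"
      then have "0 < x" using that by auto
      have "partial_t T u t x - \<epsilon> * partial_x (partial_x u) t x = 0" using ns that(1) \<open>0 < x\<close> by blast
      \<comment> \<open>\<open>R_ns\<close> rescales its argument by \<open>sqrt \<epsilon>\<close>,
        so evaluation at \<open>x / sqrt \<epsilon>\<close> returns the heat residual of
        \<open>ua\<close> at \<open>x\<close> itself, divided by \<open>\<epsilon>\<close>.\<close>
      then have "?vt t x - \<epsilon> * ?vxx t x = - \<epsilon> * R_ns T \<epsilon> ua t (x / sqrt \<epsilon>)"
        using \<open>0 < \<epsilon>\<close> ua.partial_t_eq[OF that(1) \<open>0 < x\<close>] ua.partial_xx_eq[OF that(1) \<open>0 < x\<close>]
        by (simp add: R_ns_def) (simp add: algebra_simps)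
      then show "(?vt t x - \<epsilon> * ?vxx t x)\<^sup>2 = \<epsilon>\<^sup>2 * (R_ns T \<epsilon> ua t (x / sqrt \<epsilon>))\<^sup>2"
        by (simp add: power_mult_distrib)
    qed
    also have "\<dots> = \<epsilon>\<^sup>2 * integral {a..L} (\<lambda>x. (R_ns T \<epsilon> ua t (x / sqrt \<epsilon>))\<^sup>2)" by simp
    also have "\<dots> \<le> N"
      unfolding N_def
    proof (rule mult_left_mono)
      have "integral {a..L} (\<lambda>x. (R_ns T \<epsilon> ua t (x / sqrt \<epsilon>))\<^sup>2) \<le> L2_sq {0<..} (\<lambda>x. R_ns T \<epsilon> ua t (x / sqrt \<epsilon>))"
        using R(1)[of t] that by (intro integral_subset_le_L2_sq) auto
      also have "\<dots> \<le> C * sqrt \<epsilon>" using R(2)[of t] that by simp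
      finally show "integral {a..L} (\<lambda>x. (R_ns T \<epsilon> ua t (x / sqrt \<epsilon>))\<^sup>2) \<le> C * sqrt \<epsilon>" .
    qed simp
    finally show ?thesis .
  qed
  have P: "integral {s..\<tau>} (\<lambda>t. (?v t 0 - \<epsilon> * K * ?vx t 0)\<^sup>2) \<le> P" if "0 < s" "\<tau> \<le> T" for s \<tau>
  proof -
    have e3: "(\<epsilon> powr (3 / 2))\<^sup>2 = \<epsilon> ^ 3"
      using \<open>0 < \<epsilon>\<close> by (simp add: powr_power)
    have "integral {s..\<tau>} (\<lambda>t. (?v t 0 - \<epsilon> * K * ?vx t 0)\<^sup>2) = integral {s..\<tau>} (\<lambda>t. \<epsilon> ^ 3 * (b_ns T K J \<epsilon> uw ua t)\<^sup>2)"
    proof (rule integral_cong)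
      fix t assume "t \<in> {s..\<tau>}"
      then have t: "t \<in> {0<..T}" using that by auto
      have "u t 0 - \<epsilon> * K * partial_x u t 0 = uw t + \<epsilon> * J * ddt T uw t" using ns t by blast
      then have "?v t 0 - \<epsilon> * K * ?vx t 0 = - (\<epsilon> powr (3 / 2)) * b_ns T K J \<epsilon> uw ua t"
        using \<open>0 < \<epsilon>\<close> ua.partial_x_eq[OF t, of 0] by (simp add: b_ns_def) (simp add: algebra_simps)
      then show "(?v t 0 - \<epsilon> * K * ?vx t 0)\<^sup>2 = \<epsilon> ^ 3 * (b_ns T K J \<epsilon> uw ua t)\<^sup>2"
        by (simp add: power_mult_distrib e3)
    qed
    also have "\<dots> = \<epsilon> ^ 3 * integral {s..\<tau>} (\<lambda>t. (b_ns T K J \<epsilon> uw ua t)\<^sup>2)" by simp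
    also have "\<dots> \<le> P"
      unfolding P_def
    proof (rule mult_left_mono)
      have "integral {s..\<tau>} (\<lambda>t. (b_ns T K J \<epsilon> uw ua t)\<^sup>2) \<le> L2_sq {0..T} (b_ns T K J \<epsilon> uw ua)"
        using b(1) that by (intro integral_subset_le_L2_sq) auto
      then show "integral {s..\<tau>} (\<lambda>t. (b_ns T K J \<epsilon> uw ua t)\<^sup>2) \<le> C" using b(2) by simp
    qed (use \<open>0 < \<epsilon>\<close> in simp)
    finally show ?thesis .
  qed
  have zero: "?v 0 x = 0" if "0 \<le> x" for x using ns ua0 that by simp
  note est = v.robin_L2_estimate[OF \<open>0 < T\<close> \<open>0 < \<epsilon>\<close> \<open>0 < K\<close> zero N P t]
  show "square_integrable_on {0..} (?v t)" "square_integrable_on {0..T} (\<lambda>s. ?v s 0)"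
    using est(1,3) by auto
  \<comment> \<open>\<open>C\<close> bounds a squared norm; its sign is needed to compare powers of
    \<open>\<epsilon>\<close>.\<close>
  have "0 \<le> C" using L2_sq_nonneg b(2) by (rule order_trans)
  have "T * N + P / K \<le> C * (T + 1 / K) * \<epsilon> powr (5 / 2)"
  proof -
    have "\<epsilon>\<^sup>2 * sqrt \<epsilon> = \<epsilon> powr 2 * \<epsilon> powr (1 / 2)"
      using \<open>0 < \<epsilon>\<close> by (simp add: powr_half_sqrt powr_numeral)
    then have 1: "\<epsilon>\<^sup>2 * sqrt \<epsilon> = \<epsilon> powr (5 / 2)" by (simp add: powr_add[symmetric])
    \<comment> \<open>Here \<open>\<epsilon> \<le> 1\<close> enters: the boundary residual is
      smaller than the source by half a power, so the source determines the rate.\<close>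
    have "\<epsilon> powr 3 \<le> \<epsilon> powr (5 / 2)" using \<open>0 < \<epsilon>\<close> \<open>\<epsilon> \<le> 1\<close> by (intro powr_mono') auto
    then have "\<epsilon> ^ 3 \<le> \<epsilon> powr (5 / 2)" using \<open>0 < \<epsilon>\<close> by (simp add: powr_numeral)
    then have "P \<le> \<epsilon> powr (5 / 2) * C" unfolding P_def using \<open>0 \<le> C\<close> by (rule mult_right_mono)
    then have "P / K \<le> \<epsilon> powr (5 / 2) * C / K" using \<open>0 < K\<close> by (simp add: divide_right_mono)
    moreover have "N = C * \<epsilon> powr (5 / 2)" unfolding N_def 1[symmetric] by simp
    ultimately show ?thesis by (simp add: algebra_simps)
  qed
  then have "exp T * (T * N + P / K) \<le> exp T * (C * (T + 1 / K) * \<epsilon> powr (5 / 2))" by simp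
  then have Q: "exp T * (T * N + P / K) \<le> A * \<epsilon> powr (5 / 2)" by (simp add: A_def mult_ac)
  have "sqrt (\<epsilon> powr (5 / 2)) = \<epsilon> powr (5 / 4)" by (simp add: powr_half_sqrt[symmetric] powr_powr)
  then have sq: "sqrt (X * \<epsilon> powr (5 / 2)) = sqrt X * \<epsilon> powr (5 / 4)" for X by (simp add: real_sqrt_mult)
  have "L2_sq {0..} (?v t) \<le> A * \<epsilon> powr (5 / 2)" using est(2) Q by simp
  then have "sqrt (L2_sq {0..} (?v t)) \<le> sqrt A * \<epsilon> powr (5 / 4)" unfolding sq[symmetric] by simp
  moreover have "L2_sq {0..T} (\<lambda>s. ?v s 0) \<le> K * A * \<epsilon> powr (5 / 2)"
    using order_trans[OF est(4) mult_left_mono[OF Q, of K]] \<open>0 < K\<close> by (simp only: mult.assoc)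
  then have "sqrt (L2_sq {0..T} (\<lambda>s. ?v s 0)) \<le> sqrt (K * A) * \<epsilon> powr (5 / 4)" unfolding sq[symmetric] by simp
  ultimately show "sqrt (L2_sq {0..} (?v t)) + sqrt (L2_sq {0..T} (\<lambda>s. ?v s 0))
      \<le> (sqrt A + sqrt (K * A)) * \<epsilon> powr (5 / 4)" by (simp add: distrib_right)
qed

theorem theorem3p3:
  fixes M :: nat and chi T K J :: real
    and R\<^sub>e R\<^sub>o \<Lambda> :: "real mat"
    and uw :: "real \<Rightarrow> real"
    and u0 u1 u2 :: "real \<Rightarrow> real \<Rightarrow> real"
  assumes "odd M" "3 \<le> M" "0 < chi" "chi \<le> 1" "0 < T"
    and "spectral_frame M R\<^sub>e R\<^sub>o \<Lambda>"
    and "K = K_coef M chi R\<^sub>e R\<^sub>o" "J = J_coef M chi R\<^sub>e R\<^sub>o"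
    and "uw differentiable_on {0..T}" "uw 0 = 0"
    and "viscous_layer T K J uw u0 u1 u2"
    and "residual_bounds T K J uw (u_ns_a u0 u1 u2)"
  shows "\<exists>C. \<forall>\<epsilon>\<in>{0<..1}. \<forall>u_ns. ns_solution T K J \<epsilon> uw u_ns \<longrightarrow>
    (\<forall>t\<in>{0..T}.
      square_integrable_on {0..} (\<lambda>x. u_ns t x - u_ns_a u0 u1 u2 \<epsilon> t x) \<and>
      square_integrable_on {0..T} (\<lambda>s. u_ns s 0 - u_ns_a u0 u1 u2 \<epsilon> s 0) \<and>
      sqrt (L2_sq {0..} (\<lambda>x. u_ns t x - u_ns_a u0 u1 u2 \<epsilon> t x))
        + sqrt (L2_sq {0..T} (\<lambda>s. u_ns s 0 - u_ns_a u0 u1 u2 \<epsilon> s 0))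
      \<le> C * \<epsilon> powr (5 / 4))"
proof -
  have "0 < K" using assms K_coef_pos by blast
  note layer = assms(11)[unfolded viscous_layer_def]
  obtain C where C: "\<And>\<epsilon> t. \<epsilon> \<in> {0<..1} \<Longrightarrow> t \<in> {0..T} \<Longrightarrow>
        square_integrable_on {0<..} (\<lambda>x. R_ns T \<epsilon> (u_ns_a u0 u1 u2 \<epsilon>) t (x / sqrt \<epsilon>)) \<and>
        L2_sq {0<..} (\<lambda>x. R_ns T \<epsilon> (u_ns_a u0 u1 u2 \<epsilon>) t (x / sqrt \<epsilon>)) \<le> C * sqrt \<epsilon>"
      "\<And>\<epsilon>. \<epsilon> \<in> {0<..1} \<Longrightarrow> square_integrable_on {0..T} (b_ns T K J \<epsilon> uw (u_ns_a u0 u1 u2 \<epsilon>)) \<and>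
        L2_sq {0..T} (b_ns T K J \<epsilon> uw (u_ns_a u0 u1 u2 \<epsilon>)) \<le> C"
    using assms(12) unfolding residual_bounds_def by blast
  \<comment> \<open>The constant depends on \<open>T\<close>, \<open>K\<close> and the residual
    constant \<open>C\<close> only, and is fixed before \<open>\<epsilon>\<close> and the solution
    are introduced.\<close>
  define A where "A = exp T * (C * (T + 1 / K))"
  show ?thesis
  proof (intro exI[of _ "sqrt A + sqrt (K * A)"] ballI allI impI)
    fix \<epsilon> u_ns t
    assume \<epsilon>: "\<epsilon> \<in> {0<..1}" and ns: "ns_solution T K J \<epsilon> uw u_ns" and t: "t \<in> {0..T}"
    have bc: "bounded_classical T u0" "bounded_classical T u1" "bounded_classical T u2"
      and zi: "zero_initial u0" "zero_initial u1" "zero_initial u2"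
      using layer by auto
    have "0 < \<epsilon>" using \<epsilon> by simp
    from classical_u_ns_a[OF bc this] obtain B pt px pxx
      where ua: "classical_function T B (u_ns_a u0 u1 u2 \<epsilon>) pt px pxx" .
    have ua0: "u_ns_a u0 u1 u2 \<epsilon> 0 x = 0" if "0 \<le> x" for x
      using zi that \<open>0 < \<epsilon>\<close> by (simp add: u_ns_a_def zero_initial_def)
    show "square_integrable_on {0..} (\<lambda>x. u_ns t x - u_ns_a u0 u1 u2 \<epsilon> t x) \<and>
      square_integrable_on {0..T} (\<lambda>s. u_ns s 0 - u_ns_a u0 u1 u2 \<epsilon> s 0) \<and>
      sqrt (L2_sq {0..} (\<lambda>x. u_ns t x - u_ns_a u0 u1 u2 \<epsilon> t x))
        + sqrt (L2_sq {0..T} (\<lambda>s. u_ns s 0 - u_ns_a u0 u1 u2 \<epsilon> s 0))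
      \<le> (sqrt A + sqrt (K * A)) * \<epsilon> powr (5 / 4)"
      unfolding A_def
      using ns_error_estimate[OF \<open>0 < T\<close> \<open>0 < K\<close> \<epsilon> ns ua ua0 _ _ _ _ t] C(1)[OF \<epsilon>] C(2)[OF \<epsilon>] by blast
  qed
qed

end
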